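(* Let $A,B\subset\mathbb{X}$ be disjoint sets and let $\nu$ be a distribution on $\mathbb{X}$. Then $$\sup_{\pi\in\Pi}P_\nu^\pi(\tau_A<\tau_B,\ \tau_A<\infty)=\sup_{\pi\in\Pi_M}\sum_{x\in\mathbb{X}}\widetilde v^{\pi}(x)\nu(x)=\sum_{x\in\mathbb{X}}\widetilde V(x)\nu(x),$$ where $\widetilde V(x)=\sup_{\pi\in\Pi_M}\widetilde v^{\pi}(x)$.
   Context: Markov control model: $\mathbb{X}$ (states) and $\mathbb{U}$ (actions) are countable sets; for each $x\in\mathbb{X}$, $\mathbb{U}(x)\subset\mathbb{U}$ is the set of feasible actions; $\mathbb{K}=\{(x,u): x\in\mathbb{X},u\in\mathbb{U}(x)\}$; $Q$ is a stochastic kernel on $\mathbb{X}$ given $\mathbb{K}$. Admissible histories up to time $t$ are $H_t=\mathbb{K}^t\times\mathbb{X}$, with elements $h_t=(x_0,u_0,\dots,x_{t-1},u_{t-1},x_t)$. A policy is a sequence $\pi=\{\mu_t\}_{t\ge0}$ of stochastic kernels on $\mathbb{U}$ given $H_t$ with $\mu_t(\mathbb{U}(x_t)|h_t)=1$ for all $h_t\in H_t$; $\Pi$ is the set of all policies and $\Pi_M\subset\Pi$ the set of Markovian policies (each $\mu_t(\cdot|h_t)$ depends only on $x_t$). For $\pi\in\Pi$ and a distribution $\nu$ on $\mathbb{X}$, $P_\nu^\pi$ is the unique probability measure on $(\mathbb{X}\times\mathbb{U})^{\mathbb{N}}$ (product sigma-algebra, coordinate process $(X_t,U_t)_{t\ge0}$)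 such that $P_\nu^\pi(\mathbb{K}^{\mathbb{N}})=1$, $X_0\sim\nu$, $P_\nu^\pi(U_t\in V|h_t)=\mu_t(V|h_t)$ and $P_\nu^\pi(X_{t+1}\in C|h_t,U_t=u)=Q(C|x_t,u)$. Write $P_x^\pi$ when $\nu=\delta_x$. Hitting times: $\tau_A=\inf\{t\ge0:X_t\in A\}$ (with $\inf\emptyset=\infty$), similarly $\tau_B$. Modified kernel: $\widetilde Q$ is a stochastic kernel on $\mathbb{X}$ given $\mathbb{K}$ with $\widetilde Q(A|x,u)=1$ if $x\in A$, $\widetilde Q(B|x,u)=1$ if $x\in B$, and $\widetilde Q(\cdot|x,u)=Q(\cdot|x,u)$ otherwise. $\widetilde P_\nu^\pi$ and $\widetilde{\mathbb{E}}_\nu^\pi$ denote the measure and expectation obtained when $Q$ is replaced by $\widetilde Q$, and $$\widetilde v^{\pi}(x)=\limsup_{N\to\infty}\frac1N\,\widetilde{\mathbb{E}}_x^{\pi}\Big[\sum_{t=0}^{N-1}\mathbf{1}_A(X_t)\Big].$$ *)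

theory Defs
  imports "HOL-Probability.Probability"
begin

text \<open>
  The countable state and action sets are the types 'x and 'u, with their discrete
  sigma-algebras, so probability measures on them are pmfs.  A stochastic kernel given the
  feasible pairs is a total function; its values at infeasible pairs never matter.
\<close>

definition feasible_pairs :: "('x \<Rightarrow> 'u set) \<Rightarrow> ('x \<times> 'u) set" where
  "feasible_pairs F = {(x, u). u \<in> F x}"

text \<open>The pair \<open>([(x\<^sub>0, u\<^sub>0), \<dots>, (x\<^sub>t\<^sub>-\<^sub>1, u\<^sub>t\<^sub>-\<^sub>1)], x\<^sub>t)\<close> represents the history \<open>h\<^sub>t\<close>.\<close>

type_synonym ('x, 'u) history = "('x \<times> 'u) list \<times> 'x"

definition histories :: "('x \<Rightarrow> 'u set) \<Rightarrow> nat \<Rightarrow> ('x, 'u) history set" where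
  "histories F t = {(l, x). length l = t \<and> set l \<subseteq> feasible_pairs F}"

text \<open>Only the values of \<open>\<pi> t\<close> on \<open>histories F t\<close> are relevant.  If some
  \<open>F x\<close> is empty there is no policy, and suprema over policies in ennreal are 0.\<close>

type_synonym ('x, 'u) policy = "nat \<Rightarrow> ('x, 'u) history \<Rightarrow> 'u pmf"

definition policies :: "('x \<Rightarrow> 'u set) \<Rightarrow> ('x, 'u) policy set" where
  "policies F =
    {\<pi>. \<forall>t. \<forall>h\<in>histories F t. measure_pmf.prob (\<pi> t h) (F (snd h)) = 1}"

definition markov_policies :: "('x \<Rightarrow> 'u set) \<Rightarrow> ('x, 'u) policy set" where
  "markov_policies F =
    {\<pi> \<in> policies F. \<forall>t. \<forall>h\<in>histories F t. \<forall>h'\<in>histories F t. snd h = snd h' \<longrightarrow> \<pi> t h = \<pi> t h'}"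

definition state :: "nat \<Rightarrow> (nat \<Rightarrow> 'x \<times> 'u) \<Rightarrow> 'x" where
  "state t \<omega> = fst (\<omega> t)"

definition action :: "nat \<Rightarrow> (nat \<Rightarrow> 'x \<times> 'u) \<Rightarrow> 'u" where
  "action t \<omega> = snd (\<omega> t)"

definition history_upto :: "nat \<Rightarrow> (nat \<Rightarrow> 'x \<times> 'u) \<Rightarrow> ('x, 'u) history" where
  "history_upto t \<omega> = (map \<omega> [0..<t], state t \<omega>)"

text \<open>
  The conditional probabilities are elementary ones, given single histories; they are only
  constrained where the conditioning event has positive probability (the library's
  conditional probability given a null event is 0).
\<close>

definition is_controlled_measure ::
  "('x \<Rightarrow> 'u set) \<Rightarrow> ('x \<Rightarrow> 'u \<Rightarrow> 'x pmf) \<Rightarrow> ('x, 'u) policy \<Rightarrow> 'x pmf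
    \<Rightarrow> (nat \<Rightarrow> 'x \<times> 'u) measure \<Rightarrow> bool" where
  "is_controlled_measure F Q \<pi> \<nu> P \<longleftrightarrow>
    prob_space P \<and>
    sets P = sets (\<Pi>\<^sub>M t\<in>UNIV. count_space UNIV) \<and>
    \<P>(\<omega> in P. \<forall>t. \<omega> t \<in> feasible_pairs F) = 1 \<and>
    distr P (count_space UNIV) (state 0) = measure_pmf \<nu> \<and>
    (\<forall>t. \<forall>h\<in>histories F t. \<forall>V.
      \<P>(\<omega> in P. history_upto t \<omega> = h) > 0 \<longrightarrow>
      \<P>(\<omega> in P. action t \<omega> \<in> V \<bar> history_upto t \<omega> = h) = measure_pmf.prob (\<pi> t h) V) \<and>
    (\<forall>t. \<forall>h\<in>histories F t. \<forall>u\<in>F (snd h). \<forall>C.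
      \<P>(\<omega> in P. history_upto t \<omega> = h \<and> action t \<omega> = u) > 0 \<longrightarrow>
      \<P>(\<omega> in P. state (Suc t) \<omega> \<in> C \<bar> history_upto t \<omega> = h \<and> action t \<omega> = u)
        = measure_pmf.prob (Q (snd h) u) C)"

definition controlled_measure ::
  "('x \<Rightarrow> 'u set) \<Rightarrow> ('x \<Rightarrow> 'u \<Rightarrow> 'x pmf) \<Rightarrow> ('x, 'u) policy \<Rightarrow> 'x pmf
    \<Rightarrow> (nat \<Rightarrow> 'x \<times> 'u) measure" where
  "controlled_measure F Q \<pi> \<nu> = (THE P. is_controlled_measure F Q \<pi> \<nu> P)"

definition hitting_time :: "'x set \<Rightarrow> (nat \<Rightarrow> 'x \<times> 'u) \<Rightarrow> enat" where
  "hitting_time A \<omega> = Inf {enat t |t. state t \<omega> \<in> A}"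

definition modified_kernel ::
  "('x \<Rightarrow> 'u set) \<Rightarrow> 'x set \<Rightarrow> 'x set \<Rightarrow> ('x \<Rightarrow> 'u \<Rightarrow> 'x pmf) \<Rightarrow> ('x \<Rightarrow> 'u \<Rightarrow> 'x pmf) \<Rightarrow> bool" where
  "modified_kernel F A B Q Q' \<longleftrightarrow>
    (\<forall>(x, u)\<in>feasible_pairs F.
      (x \<in> A \<longrightarrow> measure_pmf.prob (Q' x u) A = 1) \<and>
      (x \<in> B \<longrightarrow> measure_pmf.prob (Q' x u) B = 1) \<and>
      (x \<notin> A \<and> x \<notin> B \<longrightarrow> Q' x u = Q x u))"

text \<open>The term for \<open>N = 0\<close> is \<open>0 / 0 = 0\<close> and does not affect the upper limit.\<close>

definition average_occupation ::
  "('x \<Rightarrow> 'u set) \<Rightarrow> 'x set \<Rightarrow> ('x \<Rightarrow> 'u \<Rightarrow> 'x pmf) \<Rightarrow> ('x, 'u) policy \<Rightarrow> 'x \<Rightarrow> ennreal" where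
  "average_occupation F A Q \<pi> x =
    limsup (\<lambda>N. (\<integral>\<^sup>+\<omega>. (\<Sum>t<N. indicator A (state t \<omega>))
                   \<partial>controlled_measure F Q \<pi> (return_pmf x)) / of_nat N)"

end

(*
  The stopped process is unaffected by changing the kernel on A and B, and under the modified kernel
  A and B are absorbing.  Hence P(tau_A < tau_B, tau_A < infinity) is the increasing limit of the
  probabilities that X_t lies in A under the modified kernel, which is also their Cesaro limit.
  These probabilities depend only on the joint laws of (X_t, U_t), so every policy may be replaced by
  the Markov policy that draws U_t from its conditional law given X_t (Derman and Strauch).  The
  supremum passes through the sum over initial states because policies chosen separately for each
  initial state can be glued into one policy that remembers X_0.
*)
theory Submission
  imports Defs
begin

text \<open>Remembering \<open>X_0\<close> destroys the Markov property, and the Markov version of a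
  policy depends on the initial law. So the two constructions are used in a fixed order: gluing
  leads from separate initial states to a general policy started in \<open>\<nu>\<close>, and only
  then is a policy made Markov, for this \<open>\<nu>\<close>. A second obstacle is that
  \<open>Q'\<close> confines the process to \<open>A\<close> or to \<open>B\<close> without freezing
  it, so after the first visit the two kernels may produce different paths. They are compared
  through the history stopped at that visit, whose law is the same for both. Finally, the controlled
  measure is a definite description in terms of elementary conditional probabilities. It is shown to
  be the unique measure with prescribed laws of finite histories; these laws are discrete, so most
  of the argument is about pmfs, and measures on trajectories matter only at its start and its
  end.\<close>

section \<open>Random sequences with prescribed prefix laws\<close>

text \<open>This is the Ionescu-Tulcea theorem for discrete coordinates, with prefixes as lists: the
  law of the first \<open>n\<close> coordinates obeys the same recursion as \<open>L\<close>. Finite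
  products of countable discrete spaces are discrete, so the kernels are measurable for
  free.\<close>

lemma process_extension:
  fixes K :: "nat \<Rightarrow> 'a::countable list \<Rightarrow> 'a pmf" and L :: "nat \<Rightarrow> 'a list pmf"
  assumes L_0: "L 0 = return_pmf []"
    and L_Suc: "\<And>n. L (Suc n) = bind_pmf (L n) (\<lambda>l. map_pmf (\<lambda>a. l @ [a]) (K n l))"
  obtains P :: "(nat \<Rightarrow> 'a) measure" where "prob_space P"
    and "sets P = sets (\<Pi>\<^sub>M t\<in>UNIV. count_space UNIV)"
    and "\<And>n. distr P (count_space UNIV) (\<lambda>\<omega>. map \<omega> [0..<n]) = measure_pmf (L n)"
proof -
  define M where "M = (\<lambda>_::nat. count_space (UNIV :: 'a set))"
  have PiM_M: "PiM {0..<n} M = count_space (PiE {0..<n} (\<lambda>_. UNIV))" for n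
    unfolding M_def by (intro count_space_PiM_finite) auto
  interpret IT: Ionescu_Tulcea "\<lambda>n \<omega>. measure_pmf (K n (map \<omega> [0..<n]))" M
  proof
    show "(\<lambda>\<omega>. measure_pmf (K n (map \<omega> [0..<n]))) \<in> measurable (PiM {0..<n} M) (subprob_algebra (M n))" for n
      unfolding PiM_M by (simp add: M_def measure_pmf_in_subprob_algebra)
  qed
  \<comment> \<open>The product over the empty index set has one point; started there,
    \<open>IT.C 0 n ?u\<close> is the joint law of the first \<open>n\<close> coordinates.\<close>
  let ?u = "\<lambda>_::nat. undefined :: 'a"
  have u: "?u \<in> space (PiM {0..<0} M)"
    by (simp add: space_PiM)
  have law_C: "distr (IT.C 0 n ?u) (count_space UNIV) (\<lambda>\<omega>. map \<omega> [0..<n]) = measure_pmf (L n)" for n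
  proof (induction n)
    case 0
    show ?case
      by (simp add: L_0 return_pmf.rep_eq distr_return PiM_M)
  next
    case (Suc n)
    have spC: "space (IT.C 0 n ?u) = space (PiM {0..<n} M)" "sets (IT.C 0 n ?u) = sets (PiM {0..<n} M)"
      using IT.space_C[OF u, of n] IT.sets_C[OF u, of n] by auto
    have mC: "measurable (IT.C 0 n ?u) N = measurable (PiM {0..<n} M) N" for N
      by (intro measurable_cong_sets spC refl)
    have ne: "space (IT.C 0 n ?u) \<noteq> {}"
      using IT.prob_space_C[OF u, of n] by (rule prob_space.not_empty)
    have "distr (IT.C 0 (Suc n) ?u) (count_space UNIV) (\<lambda>\<omega>. map \<omega> [0..<Suc n])
        = IT.C 0 n ?u \<bind> (\<lambda>\<omega>. distr (IT.eP n \<omega>) (count_space UNIV) (\<lambda>\<omega>. map \<omega> [0..<Suc n]))"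
      unfolding IT.C.simps
      apply (subst distr_bind[where K = "PiM {0..<Suc n} M"])
      using IT.measurable_eP[of n]
      by (auto simp: mC ne PiM_M)
    also have "\<dots> = IT.C 0 n ?u \<bind> (\<lambda>\<omega>. measure_pmf (map_pmf (\<lambda>a. map \<omega> [0..<n] @ [a]) (K n (map \<omega> [0..<n]))))"
    proof (rule bind_cong[OF refl])
      fix \<omega> assume "\<omega> \<in> space (IT.C 0 n ?u)"
      then have w: "\<omega> \<in> space (PiM {0..<n} M)" by (simp add: spC)
      have "distr (IT.eP n \<omega>) (count_space UNIV) (\<lambda>\<omega>. map \<omega> [0..<Suc n])
         = distr (measure_pmf (K n (map \<omega> [0..<n]))) (count_space UNIV)
             ((\<lambda>\<omega>. map \<omega> [0..<Suc n]) \<circ> fun_upd \<omega> n)"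
        unfolding IT.eP_def using w
        by (intro distr_distr) (auto simp: PiM_M PiE_def extensional_def)
      also have "(\<lambda>\<omega>. map \<omega> [0..<Suc n]) \<circ> fun_upd \<omega> n = (\<lambda>a. map \<omega> [0..<n] @ [a])"
        by (auto simp: fun_eq_iff)
      finally show "distr (IT.eP n \<omega>) (count_space UNIV) (\<lambda>\<omega>. map \<omega> [0..<Suc n])
        = measure_pmf (map_pmf (\<lambda>a. map \<omega> [0..<n] @ [a]) (K n (map \<omega> [0..<n])))"
        by (simp add: map_pmf_rep_eq)
    qed
    also have "\<dots> = distr (IT.C 0 n ?u) (count_space UNIV) (\<lambda>\<omega>. map \<omega> [0..<n])
        \<bind> (\<lambda>l. measure_pmf (map_pmf (\<lambda>a. l @ [a]) (K n l)))"
      by (subst bind_distr[where K = "count_space UNIV"])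
         (auto simp: mC ne PiM_M measure_pmf_in_subprob_algebra)
    also have "\<dots> = measure_pmf (L (Suc n))"
      by (simp add: Suc.IH L_Suc measure_pmf_bind)
    finally show ?case .
  qed
  have sets_lim: "sets IT.PF.lim = sets (PiM UNIV M)" by simp
  have distr_lim: "distr IT.PF.lim (count_space UNIV) (\<lambda>\<omega>. map \<omega> [0..<n]) = measure_pmf (L n)" for n
  proof -
    \<comment> \<open>\<open>IT.CI\<close> obtains the marginal on \<open>{0..<n}\<close> from the
      law of the first \<open>m \<ge> n\<close> coordinates; \<open>IT.distr_C\<close> cuts off the
      surplus ones.\<close>
    define m where "m = IT.up_to {0..<n}"
    have nm: "n \<le> m" using IT.up_to[of "{0..<n}"] by (auto simp: m_def)
    have r: "distr IT.PF.lim (PiM {0..<n} M) (\<lambda>x. restrict x {0..<n}) = IT.C 0 n ?u"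
      using IT.distr_C[OF nm u] by (simp add: IT.distr_lim IT.CI_def m_def)
    have "measure_pmf (L n)
        = distr (distr IT.PF.lim (PiM {0..<n} M) (\<lambda>x. restrict x {0..<n})) (count_space UNIV) (\<lambda>\<omega>. map \<omega> [0..<n])"
      by (simp add: r law_C)
    also have "\<dots> = distr IT.PF.lim (count_space UNIV) ((\<lambda>\<omega>. map \<omega> [0..<n]) \<circ> (\<lambda>x. restrict x {0..<n}))"
    proof (rule distr_distr)
      show "(\<lambda>\<omega>. map \<omega> [0..<n]) \<in> measurable (PiM {0..<n} M) (count_space UNIV)"
        unfolding PiM_M by simp
      show "(\<lambda>x. restrict x {0..<n}) \<in> measurable IT.PF.lim (PiM {0..<n} M)"
        unfolding measurable_cong_sets[OF sets_lim refl] by (rule measurable_restrict_subset) simp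
    qed
    also have "((\<lambda>\<omega>. map \<omega> [0..<n]) \<circ> (\<lambda>x. restrict x {0..<n})) = (\<lambda>\<omega> :: nat \<Rightarrow> 'a. map \<omega> [0..<n])"
      by (auto simp: fun_eq_iff)
    finally show ?thesis by simp
  qed
  have "prob_space IT.PF.lim"
  proof (rule prob_space_distrD)
    show "(\<lambda>\<omega>. map \<omega> [0..<0]) \<in> measurable IT.PF.lim (count_space UNIV)" by simp
    show "prob_space (distr IT.PF.lim (count_space UNIV) (\<lambda>\<omega>. map \<omega> [0..<0]))"
      unfolding distr_lim by (rule prob_space_measure_pmf)
  qed
  then show thesis
    using that distr_lim sets_lim by (simp add: M_def)
qed

lemma prefix_measurable [measurable]:
  "(\<lambda>\<omega>. map \<omega> [0..<n]) \<in> measurable (\<Pi>\<^sub>M t\<in>UNIV. count_space UNIV) (count_space (UNIV :: 'a::countable list set))"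
proof (induction n)
  case (Suc n)
  have "(\<lambda>\<omega>. (map \<omega> [0..<n], \<omega> n)) \<in> measurable (\<Pi>\<^sub>M t\<in>UNIV. count_space UNIV)
     (count_space (UNIV :: 'a list set) \<Otimes>\<^sub>M count_space UNIV)"
    using Suc by measurable
  then have "(\<lambda>\<omega>. (map \<omega> [0..<n], \<omega> n)) \<in> measurable (\<Pi>\<^sub>M t\<in>UNIV. count_space UNIV)
     (count_space (UNIV :: ('a list \<times> 'a) set))"
    by (simp add: pair_measure_countable)
  from measurable_compose[OF this, of "\<lambda>(l, a). l @ [a]"] show ?case by simp
qed auto

text \<open>Cylinders over finite index sets \<open>J\<close> determine a finite measure on the
  product, and each is a condition on a prefix long enough to cover \<open>J\<close>.\<close>

lemma measure_eqI_prefixes: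
  fixes P P' :: "(nat \<Rightarrow> 'a::countable) measure"
  assumes "prob_space P"
    and P: "sets P = sets (\<Pi>\<^sub>M t\<in>UNIV. count_space UNIV)"
    and P': "sets P' = sets (\<Pi>\<^sub>M t\<in>UNIV. count_space UNIV)"
    and eq: "\<And>n. distr P (count_space UNIV) (\<lambda>\<omega>. map \<omega> [0..<n])
               = distr P' (count_space UNIV) (\<lambda>\<omega>. map \<omega> [0..<n])"
  shows "P = P'"
proof (rule measure_eqI_PiM_infinite[OF P P'])
  interpret P: prob_space P by fact
  show "finite_measure P" by unfold_locales
  fix X :: "nat \<Rightarrow> 'a set" and J :: "nat set"
  assume J: "finite J"
  then obtain n where n: "J \<subseteq> {0..<n}"
    by (metis finite_nat_iff_bounded lessThan_atLeast0)
  let ?S = "{l. \<forall>j\<in>J. l ! j \<in> X j}"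
  have emb: "prod_emb UNIV (\<lambda>t. count_space UNIV) J (Pi\<^sub>E J X) = (\<lambda>\<omega>. map \<omega> [0..<n]) -` ?S"
    using n by (auto simp: prod_emb_def PiE_iff subset_eq)
  have "emeasure N ((\<lambda>\<omega>. map \<omega> [0..<n]) -` ?S)
      = emeasure (distr N (count_space UNIV) (\<lambda>\<omega>. map \<omega> [0..<n])) ?S"
    if "sets N = sets (\<Pi>\<^sub>M t\<in>UNIV. count_space UNIV)" for N
    using that sets_eq_imp_space_eq[OF that]
    by (subst emeasure_distr) (auto simp: measurable_cong_sets[OF that refl] space_PiM)
  then show "emeasure P (prod_emb UNIV (\<lambda>t. count_space UNIV) J (Pi\<^sub>E J X))
      = emeasure P' (prod_emb UNIV (\<lambda>t. count_space UNIV) J (Pi\<^sub>E J X))"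
    unfolding emb using P P' eq by simp
qed

section \<open>Joint laws and elementary conditional probabilities\<close>

lemma emeasure_bind_Pair_pmf:
  "emeasure (measure_pmf (bind_pmf p (\<lambda>x. map_pmf (Pair x) (k x)))) ({x} \<times> V)
    = ennreal (pmf p x * measure_pmf.prob (k x) V)"
proof -
  have "emeasure (measure_pmf (bind_pmf p (\<lambda>x. map_pmf (Pair x) (k x)))) ({x} \<times> V)
      = (\<integral>\<^sup>+x'. ennreal (measure_pmf.prob (k x) V) * indicator {x} x' \<partial>measure_pmf p)"
    unfolding emeasure_bind_pmf
  proof (rule nn_integral_cong)
    fix x'
    have "Pair x' -` ({x} \<times> V) = (if x' = x then V else {})" by auto
    then show "emeasure (measure_pmf (map_pmf (Pair x') (k x'))) ({x} \<times> V)
        = ennreal (measure_pmf.prob (k x) V) * indicator {x} x'"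
      by (simp add: measure_pmf.emeasure_eq_measure)
  qed
  also have "\<dots> = ennreal (pmf p x * measure_pmf.prob (k x) V)"
    by (subst nn_integral_cmult_indicator) (auto simp: emeasure_pmf_single ennreal_mult' mult.commute)
  finally show ?thesis .
qed

text \<open>For discrete variables a joint law amounts to a marginal with elementary conditional
  probabilities. These are tested only at the atoms of \<open>X\<close>: off the support of
  \<open>p\<close> both joint probabilities vanish.\<close>

lemma distr_pair_pmf_iff:
  fixes X :: "'w \<Rightarrow> 'a::countable" and Y :: "'w \<Rightarrow> 'b::countable"
  assumes P: "prob_space P"
    and [measurable]: "X \<in> measurable P (count_space UNIV)" "Y \<in> measurable P (count_space UNIV)"
    and X: "distr P (count_space UNIV) X = measure_pmf p"
  shows "distr P (count_space UNIV) (\<lambda>\<omega>. (X \<omega>, Y \<omega>))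
        = measure_pmf (bind_pmf p (\<lambda>x. map_pmf (Pair x) (k x))) \<longleftrightarrow>
    (\<forall>x\<in>set_pmf p. \<forall>V. \<P>(\<omega> in P. Y \<omega> \<in> V \<bar> X \<omega> = x) = measure_pmf.prob (k x) V)"
    (is "?D = ?B \<longleftrightarrow> _")
proof -
  interpret prob_space P by fact
  have XY [measurable]: "(\<lambda>\<omega>. (X \<omega>, Y \<omega>)) \<in> measurable P (count_space UNIV)"
    using measurable_Pair[of X P "count_space UNIV" Y "count_space UNIV"]
    by (simp add: pair_measure_countable)
  have pX: "\<P>(\<omega> in P. X \<omega> = x) = pmf p x" for x
  proof -
    have "pmf p x = measure (distr P (count_space UNIV) X) {x}"
      by (simp add: X measure_pmf_single)
    also have "\<dots> = \<P>(\<omega> in P. X \<omega> = x)"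
      by (subst measure_distr) (auto intro!: arg_cong[where f = "measure P"])
    finally show ?thesis by simp
  qed
  have D: "emeasure ?D ({x} \<times> V) = ennreal (\<P>(\<omega> in P. Y \<omega> \<in> V \<and> X \<omega> = x))" for x V
    by (subst emeasure_distr) (auto simp: emeasure_eq_measure intro!: arg_cong[where f = "measure P"])
  have D0: "\<P>(\<omega> in P. Y \<omega> \<in> V \<and> X \<omega> = x) = 0" if "x \<notin> set_pmf p" for x V
  proof -
    have "\<P>(\<omega> in P. Y \<omega> \<in> V \<and> X \<omega> = x) \<le> \<P>(\<omega> in P. X \<omega> = x)"
      by (intro finite_measure_mono) auto
    then show ?thesis
      using that measure_nonneg[of P "{\<omega> \<in> space P. Y \<omega> \<in> V \<and> X \<omega> = x}"]
      by (simp add: pX set_pmf_iff del: measure_nonneg)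
  qed
  \<comment> \<open>Intermediate form without division: both laws are compared on the rectangles
    \<open>{x} \<times> V\<close>, and by countability singletons \<open>V\<close> already suffice
    for equality.\<close>
  have "?D = ?B \<longleftrightarrow> (\<forall>x V. \<P>(\<omega> in P. Y \<omega> \<in> V \<and> X \<omega> = x) = pmf p x * measure_pmf.prob (k x) V)"
  proof
    assume "?D = ?B"
    then have "ennreal (\<P>(\<omega> in P. Y \<omega> \<in> V \<and> X \<omega> = x)) = ennreal (pmf p x * measure_pmf.prob (k x) V)" for x V
      unfolding D[symmetric] emeasure_bind_Pair_pmf[symmetric] by simp
    then show "\<forall>x V. \<P>(\<omega> in P. Y \<omega> \<in> V \<and> X \<omega> = x) = pmf p x * measure_pmf.prob (k x) V"
      by (subst (asm) ennreal_inj) auto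
  next
    assume *: "\<forall>x V. \<P>(\<omega> in P. Y \<omega> \<in> V \<and> X \<omega> = x) = pmf p x * measure_pmf.prob (k x) V"
    have "emeasure ?D ({x} \<times> {y}) = emeasure ?B ({x} \<times> {y})" for x y
      unfolding D emeasure_bind_Pair_pmf *[rule_format] ..
    moreover have "{x} \<times> {y} = {(x, y)}" for x :: 'a and y :: 'b by simp
    ultimately have "emeasure ?D {(x, y)} = emeasure ?B {(x, y)}" for x y
      by metis
    then show "?D = ?B"
      by (intro measure_eqI_countable[where A = UNIV]) auto
  qed
  also have "\<dots> \<longleftrightarrow> (\<forall>x\<in>set_pmf p. \<forall>V. \<P>(\<omega> in P. Y \<omega> \<in> V \<and> X \<omega> = x) = pmf p x * measure_pmf.prob (k x) V)"
    using D0 by (auto simp: pmf_eq_0_set_pmf)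
  also have "\<dots> \<longleftrightarrow> (\<forall>x\<in>set_pmf p. \<forall>V. \<P>(\<omega> in P. Y \<omega> \<in> V \<bar> X \<omega> = x) = measure_pmf.prob (k x) V)"
    by (intro ball_cong refl) (auto simp: cond_prob_def pX set_pmf_iff divide_eq_eq mult.commute)
  finally show ?thesis .
qed

section \<open>Laws of finite histories and the controlled measure\<close>

definition history_step ::
  "('x \<Rightarrow> 'u \<Rightarrow> 'x pmf) \<Rightarrow> ('x, 'u) policy \<Rightarrow> nat \<Rightarrow> ('x, 'u) history \<Rightarrow> ('x, 'u) history pmf" where
  "history_step Q \<pi> t h =
    bind_pmf (\<pi> t h) (\<lambda>u. map_pmf (Pair (fst h @ [(snd h, u)])) (Q (snd h) u))"

text \<open>This will be the law of \<open>history_upto t\<close> under the controlled measure,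
  constructed without that measure.\<close>

primrec history_pmf ::
  "('x \<Rightarrow> 'u \<Rightarrow> 'x pmf) \<Rightarrow> ('x, 'u) policy \<Rightarrow> 'x pmf \<Rightarrow> nat \<Rightarrow> ('x, 'u) history pmf" where
  "history_pmf Q \<pi> \<nu> 0 = map_pmf (Pair []) \<nu>"
| "history_pmf Q \<pi> \<nu> (Suc t) = bind_pmf (history_pmf Q \<pi> \<nu> t) (history_step Q \<pi> t)"

lemma policies_set_pmf:
  assumes "\<pi> \<in> policies F" "h \<in> histories F t"
  shows "set_pmf (\<pi> t h) \<subseteq> F (snd h)"
  using assms by (auto simp: policies_def measure_pmf.prob_eq_1 AE_measure_pmf_iff)

lemma set_history_pmf:
  assumes "\<pi> \<in> policies F"
  shows "set_pmf (history_pmf Q \<pi> \<nu> t) \<subseteq> histories F t"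
proof (induction t)
  case 0
  show ?case by (auto simp: histories_def)
next
  case (Suc t)
  have "h' \<in> histories F (Suc t)"
    if h: "h \<in> histories F t" and h': "h' \<in> set_pmf (history_step Q \<pi> t h)" for h h'
    using policies_set_pmf[OF assms h] h h'
    by (auto simp: history_step_def histories_def feasible_pairs_def)
  with Suc show ?case by auto
qed

lemma map_fst_history_pmf_Suc:
  "map_pmf fst (history_pmf Q \<pi> \<nu> (Suc t))
    = bind_pmf (history_pmf Q \<pi> \<nu> t) (\<lambda>h. map_pmf (\<lambda>u. fst h @ [(snd h, u)]) (\<pi> t h))"
  by (simp add: map_bind_pmf history_step_def pmf.map_comp o_def)
     (simp add: map_pmf_def)

text \<open>A history grows by an action and then a state, while a coordinate of the process is a
  state and then an action. The regrouping isolates the draw of the current state, which depends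
  only on the last completed pair, or is made from \<open>\<nu>\<close> if there is none.\<close>

lemma history_pmf_from_prefix:
  "history_pmf Q \<pi> \<nu> t = bind_pmf (map_pmf fst (history_pmf Q \<pi> \<nu> t))
     (\<lambda>l. map_pmf (Pair l) (if l = [] then \<nu> else Q (fst (last l)) (snd (last l))))"
proof (cases t)
  case 0
  then show ?thesis by (simp add: pmf.map_comp o_def bind_return_pmf)
next
  case (Suc t')
  show ?thesis
    unfolding Suc map_fst_history_pmf_Suc
    by (simp add: history_step_def[abs_def] bind_assoc_pmf bind_map_pmf)
qed

text \<open>The regrouping, carried on to the next action, yields the recursion that
  \<open>process_extension\<close> expects.\<close>

lemma map_fst_history_pmf_kernel:
  "map_pmf fst (history_pmf Q \<pi> \<nu> (Suc t)) = bind_pmf (map_pmf fst (history_pmf Q \<pi> \<nu> t))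
     (\<lambda>l. map_pmf (\<lambda>a. l @ [a])
       (bind_pmf (if l = [] then \<nu> else Q (fst (last l)) (snd (last l)))
         (\<lambda>x. map_pmf (Pair x) (\<pi> t (l, x)))))"
  unfolding map_fst_history_pmf_Suc
  by (subst history_pmf_from_prefix)
     (simp add: bind_assoc_pmf bind_map_pmf map_bind_pmf pmf.map_comp o_def)

text \<open>The history at time \<open>Suc t\<close> determines the history and the action at time
  \<open>t\<close>: the last entry of its list consists of the state and the action at time
  \<open>t\<close>.\<close>

lemma history_action_pmf:
  "map_pmf (\<lambda>(l, y). ((butlast l, fst (last l)), snd (last l))) (history_pmf Q \<pi> \<nu> (Suc t))
    = bind_pmf (history_pmf Q \<pi> \<nu> t) (\<lambda>h. map_pmf (Pair h) (\<pi> t h))"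
  by (simp add: map_bind_pmf history_step_def pmf.map_comp o_def)
     (simp add: map_pmf_def)

lemma history_action_state_pmf:
  "map_pmf (\<lambda>(l, y). (((butlast l, fst (last l)), snd (last l)), y)) (history_pmf Q \<pi> \<nu> (Suc t))
    = bind_pmf (bind_pmf (history_pmf Q \<pi> \<nu> t) (\<lambda>h. map_pmf (Pair h) (\<pi> t h)))
        (\<lambda>hu. map_pmf (Pair hu) (Q (snd (fst hu)) (snd hu)))"
  by (simp add: map_bind_pmf history_step_def pmf.map_comp o_def bind_assoc_pmf bind_map_pmf)

lemma history_upto_Suc:
  "history_upto (Suc t) \<omega> = (fst (history_upto t \<omega>) @ [(snd (history_upto t \<omega>), action t \<omega>)], state (Suc t) \<omega>)"
  by (simp add: history_upto_def state_def action_def)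

lemma history_upto_measurable [measurable]:
  "history_upto t \<in> measurable (\<Pi>\<^sub>M t\<in>UNIV. count_space UNIV)
     (count_space (UNIV :: ('x::countable, 'u::countable) history set))"
  using measurable_compose[OF prefix_measurable[of "Suc t"],
      of "\<lambda>l. (butlast l, fst (last l))" "count_space (UNIV :: ('x, 'u) history set)"]
  by (simp add: history_upto_def[abs_def] state_def)

text \<open>Forwards, by induction on \<open>t\<close>, the two kernel clauses turn the law of a
  history into its joint law with the action, and then with the next state. Backwards, both joint
  laws are images of the law of the next history, and \<open>distr_pair_pmf_iff\<close> reads the
  conditional probabilities off them.\<close>

lemma is_controlled_measure_iff:
  fixes F :: "'x::countable \<Rightarrow> 'u::countable set"
  assumes \<pi>: "\<pi> \<in> policies F"
  shows "is_controlled_measure F Q \<pi> \<nu> P \<longleftrightarrow>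
    prob_space P \<and> sets P = sets (\<Pi>\<^sub>M t\<in>UNIV. count_space UNIV) \<and>
    (\<forall>t. distr P (count_space UNIV) (history_upto t) = measure_pmf (history_pmf Q \<pi> \<nu> t))"
    (is "_ \<longleftrightarrow> ?R")
proof (cases "prob_space P \<and> sets P = sets (\<Pi>\<^sub>M t\<in>UNIV. count_space UNIV)")
  case True
  then have P: "prob_space P" and sets_P: "sets P = sets (\<Pi>\<^sub>M t\<in>UNIV. count_space UNIV)"
    by auto
  interpret prob_space P by fact
  note mP = measurable_cong_sets[OF sets_P refl]
  have hist [measurable]: "history_upto t \<in> measurable P (count_space UNIV)" for t
    by (simp add: mP)
  have st [measurable]: "state t \<in> measurable P (count_space UNIV)" for t
    unfolding mP state_def by (rule measurable_compose[OF measurable_component_singleton]) auto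
  have act [measurable]: "action t \<in> measurable P (count_space UNIV)" for t
    unfolding mP action_def by (rule measurable_compose[OF measurable_component_singleton]) auto
  have hist_act [measurable]: "(\<lambda>\<omega>. (history_upto t \<omega>, action t \<omega>)) \<in> measurable P (count_space UNIV)" for t
    using measurable_Pair[OF hist act, of t t] by (simp add: pair_measure_countable)
  define H where "H = history_pmf Q \<pi> \<nu>"
  define HU where "HU t = bind_pmf (H t) (\<lambda>h. map_pmf (Pair h) (\<pi> t h))" for t
  have set_HU: "hu \<in> set_pmf (HU t) \<longleftrightarrow> fst hu \<in> set_pmf (H t) \<and> snd hu \<in> set_pmf (\<pi> t (fst hu))" for hu t
    by (cases hu) (auto simp: HU_def)
  have HF: "h \<in> histories F t" if "h \<in> set_pmf (H t)" for h t
    using set_history_pmf[OF \<pi>] that by (auto simp: H_def)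
  have distr_map: "distr P (count_space UNIV) (\<lambda>\<omega>. f (X \<omega>)) = measure_pmf (map_pmf f p)"
    if "distr P (count_space UNIV) X = measure_pmf p" "X \<in> measurable P (count_space UNIV)"
    for X :: "(nat \<Rightarrow> 'x \<times> 'u) \<Rightarrow> 'c" and f :: "'c \<Rightarrow> 'd" and p
    unfolding map_pmf_rep_eq that(1)[symmetric] using that(2) by (subst distr_distr) (auto simp: o_def)
  have act_iff: "distr P (count_space UNIV) (\<lambda>\<omega>. (history_upto t \<omega>, action t \<omega>)) = measure_pmf (HU t)
     \<longleftrightarrow> (\<forall>h\<in>set_pmf (H t). \<forall>V. \<P>(\<omega> in P. action t \<omega> \<in> V \<bar> history_upto t \<omega> = h) = measure_pmf.prob (\<pi> t h) V)"
    if "distr P (count_space UNIV) (history_upto t) = measure_pmf (H t)" for t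
    unfolding HU_def using that by (intro distr_pair_pmf_iff P hist act)
  have state_iff: "distr P (count_space UNIV) (\<lambda>\<omega>. ((history_upto t \<omega>, action t \<omega>), state (Suc t) \<omega>))
       = measure_pmf (bind_pmf (HU t) (\<lambda>hu. map_pmf (Pair hu) (Q (snd (fst hu)) (snd hu))))
     \<longleftrightarrow> (\<forall>hu\<in>set_pmf (HU t). \<forall>C. \<P>(\<omega> in P. state (Suc t) \<omega> \<in> C \<bar> (history_upto t \<omega>, action t \<omega>) = hu)
           = measure_pmf.prob (Q (snd (fst hu)) (snd hu)) C)"
    if "distr P (count_space UNIV) (\<lambda>\<omega>. (history_upto t \<omega>, action t \<omega>)) = measure_pmf (HU t)" for t
    using that by (intro distr_pair_pmf_iff P hist_act st)
  \<comment> \<open>The positivity premises of the definition thus say that the conditioning value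
    lies in the support, which is where \<open>distr_pair_pmf_iff\<close> tests the conditional
    probabilities.\<close>
  have pos_iff: "\<P>(\<omega> in P. X \<omega> = x) > 0 \<longleftrightarrow> x \<in> set_pmf p"
    if "distr P (count_space UNIV) X = measure_pmf p" "X \<in> measurable P (count_space UNIV)"
    for X :: "(nat \<Rightarrow> 'x \<times> 'u) \<Rightarrow> 'c" and p x
  proof -
    have "pmf p x = measure (distr P (count_space UNIV) X) {x}"
      by (simp add: that measure_pmf_single)
    also have "\<dots> = \<P>(\<omega> in P. X \<omega> = x)"
      using that(2) by (subst measure_distr) (auto intro!: arg_cong[where f = "measure P"])
    finally show ?thesis by (metis pmf_positive_iff)
  qed
  have state_0: "state 0 = (\<lambda>\<omega>. snd (history_upto 0 \<omega>))" "history_upto 0 = (\<lambda>\<omega>. ([], state 0 \<omega>))"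
    by (auto simp: history_upto_def)
  show ?thesis
  proof
    assume "is_controlled_measure F Q \<pi> \<nu> P"
    then have init: "distr P (count_space UNIV) (state 0) = measure_pmf \<nu>"
      and a: "\<And>t h V. h \<in> histories F t \<Longrightarrow> \<P>(\<omega> in P. history_upto t \<omega> = h) > 0 \<Longrightarrow>
        \<P>(\<omega> in P. action t \<omega> \<in> V \<bar> history_upto t \<omega> = h) = measure_pmf.prob (\<pi> t h) V"
      and s: "\<And>t h u C. h \<in> histories F t \<Longrightarrow> u \<in> F (snd h) \<Longrightarrow>
        \<P>(\<omega> in P. history_upto t \<omega> = h \<and> action t \<omega> = u) > 0 \<Longrightarrow>
        \<P>(\<omega> in P. state (Suc t) \<omega> \<in> C \<bar> history_upto t \<omega> = h \<and> action t \<omega> = u)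
          = measure_pmf.prob (Q (snd h) u) C"
      by (auto simp: is_controlled_measure_def)
    have "distr P (count_space UNIV) (history_upto t) = measure_pmf (H t)" for t
    proof (induction t)
      case 0
      show ?case
        unfolding state_0(2) using distr_map[OF init st, of "Pair []"] by (simp add: H_def)
    next
      case (Suc t)
      have HU: "distr P (count_space UNIV) (\<lambda>\<omega>. (history_upto t \<omega>, action t \<omega>)) = measure_pmf (HU t)"
        unfolding act_iff[OF Suc] using a HF pos_iff[OF Suc hist] by blast
      have "distr P (count_space UNIV) (\<lambda>\<omega>. ((history_upto t \<omega>, action t \<omega>), state (Suc t) \<omega>))
       = measure_pmf (bind_pmf (HU t) (\<lambda>hu. map_pmf (Pair hu) (Q (snd (fst hu)) (snd hu))))"
        unfolding state_iff[OF HU]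
      proof (intro ballI allI)
        fix hu C assume hu: "hu \<in> set_pmf (HU t)"
        obtain h u where [simp]: "hu = (h, u)" by (cases hu)
        have "h \<in> histories F t" "u \<in> set_pmf (\<pi> t h)"
          using hu HF by (auto simp: set_HU)
        moreover from this have "u \<in> F (snd h)"
          using policies_set_pmf[OF \<pi>] by blast
        ultimately show "\<P>(\<omega> in P. state (Suc t) \<omega> \<in> C \<bar> (history_upto t \<omega>, action t \<omega>) = hu)
           = measure_pmf.prob (Q (snd (fst hu)) (snd hu)) C"
          using s[of h t u C] hu pos_iff[OF HU hist_act, of hu] by simp
      qed
      from distr_map[OF this, of "\<lambda>((h, u), y). (fst h @ [(snd h, u)], y)"]
      have "distr P (count_space UNIV) (history_upto (Suc t)) =
        measure_pmf (map_pmf (\<lambda>((h, u), y). (fst h @ [(snd h, u)], y))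
          (bind_pmf (HU t) (\<lambda>hu. map_pmf (Pair hu) (Q (snd (fst hu)) (snd hu)))))"
        using measurable_Pair[OF hist_act st, of t "Suc t"]
        by (simp add: pair_measure_countable history_upto_Suc[abs_def])
      also have "map_pmf (\<lambda>((h, u), y). (fst h @ [(snd h, u)], y))
          (bind_pmf (HU t) (\<lambda>hu. map_pmf (Pair hu) (Q (snd (fst hu)) (snd hu)))) = H (Suc t)"
        by (simp add: HU_def H_def map_bind_pmf history_step_def[abs_def] pmf.map_comp o_def
            bind_assoc_pmf bind_map_pmf)
      finally show ?case .
    qed
    with P sets_P show ?R by (simp add: H_def)
  next
    assume ?R
    then have law: "distr P (count_space UNIV) (history_upto t) = measure_pmf (H t)" for t
      by (simp add: H_def)
    have HU: "distr P (count_space UNIV) (\<lambda>\<omega>. (history_upto t \<omega>, action t \<omega>)) = measure_pmf (HU t)" for t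
      using distr_map[OF law hist, of "\<lambda>(l, y). ((butlast l, fst (last l)), snd (last l))" "Suc t"]
      unfolding H_def history_action_pmf by (simp add: history_upto_Suc HU_def H_def)
    have HUS: "distr P (count_space UNIV) (\<lambda>\<omega>. ((history_upto t \<omega>, action t \<omega>), state (Suc t) \<omega>))
       = measure_pmf (bind_pmf (HU t) (\<lambda>hu. map_pmf (Pair hu) (Q (snd (fst hu)) (snd hu))))" for t
      using distr_map[OF law hist, of "\<lambda>(l, y). (((butlast l, fst (last l)), snd (last l)), y)" "Suc t"]
      unfolding H_def history_action_state_pmf by (simp add: history_upto_Suc HU_def H_def)
    have "distr P (count_space UNIV) (state 0) = measure_pmf \<nu>"
      unfolding state_0(1) using distr_map[OF law hist, of snd 0]
      by (simp add: H_def pmf.map_comp o_def pmf.map_ident)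
    moreover have "\<P>(\<omega> in P. \<forall>t. \<omega> t \<in> feasible_pairs F) = 1"
    proof -
      have "AE \<omega> in P. \<omega> t \<in> feasible_pairs F" for t
      proof -
        \<comment> \<open>The pair at time \<open>t\<close> is complete only in the history at time
          \<open>Suc t\<close>, whose entries are all feasible.\<close>
        have "AE h in measure_pmf (H (Suc t)). fst h ! t \<in> feasible_pairs F"
          using HF[of _ "Suc t"] by (fastforce simp: AE_measure_pmf_iff histories_def)
        then have "AE \<omega> in P. fst (history_upto (Suc t) \<omega>) ! t \<in> feasible_pairs F"
          unfolding law[symmetric] by (subst (asm) AE_distr_iff) auto
        then show ?thesis by (simp add: history_upto_def nth_append)
      qed
      then have "AE \<omega> in P. \<forall>t. \<omega> t \<in> feasible_pairs F"
        by (simp add: AE_all_countable)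
      moreover have "{\<omega> \<in> space P. \<forall>t. \<omega> t \<in> feasible_pairs F} \<in> sets P"
        unfolding sets_eq_imp_space_eq[OF sets_P] sets_P by measurable
      ultimately show ?thesis by (simp add: prob_Collect_eq_1)
    qed
    moreover have "\<P>(\<omega> in P. action t \<omega> \<in> V \<bar> history_upto t \<omega> = h) = measure_pmf.prob (\<pi> t h) V"
      if "\<P>(\<omega> in P. history_upto t \<omega> = h) > 0" for t h V
      using that act_iff[OF law, of t] HU pos_iff[OF law hist] by blast
    moreover have "\<P>(\<omega> in P. state (Suc t) \<omega> \<in> C \<bar> history_upto t \<omega> = h \<and> action t \<omega> = u)
          = measure_pmf.prob (Q (snd h) u) C"
      if "\<P>(\<omega> in P. history_upto t \<omega> = h \<and> action t \<omega> = u) > 0" for t h u C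
    proof -
      have "(h, u) \<in> set_pmf (HU t)"
        using that pos_iff[OF HU hist_act, of _ "(h, u)"] by simp
      then show ?thesis
        using state_iff[OF HU, of t] HUS by auto
    qed
    ultimately show "is_controlled_measure F Q \<pi> \<nu> P"
      using P sets_P by (simp add: is_controlled_measure_def)
  qed
qed (auto simp: is_controlled_measure_def)

text \<open>The definite description has a referent by \<open>process_extension\<close>, and only
  one because the laws of histories fix the laws of prefixes.\<close>

lemma controlled_measure:
  fixes F :: "'x::countable \<Rightarrow> 'u::countable set"
  assumes \<pi>: "\<pi> \<in> policies F"
  shows prob_space_controlled_measure: "prob_space (controlled_measure F Q \<pi> \<nu>)"
    and sets_controlled_measure:
      "sets (controlled_measure F Q \<pi> \<nu>) = sets (\<Pi>\<^sub>M t\<in>UNIV. count_space UNIV)"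
    and distr_controlled_measure:
      "distr (controlled_measure F Q \<pi> \<nu>) (count_space UNIV) (history_upto t)
        = measure_pmf (history_pmf Q \<pi> \<nu> t)"
proof -
  let ?L = "\<lambda>t. map_pmf fst (history_pmf Q \<pi> \<nu> t)"
  have "?L 0 = return_pmf []"
    by (simp add: pmf.map_comp o_def)
  from process_extension[of ?L, OF this map_fst_history_pmf_kernel]
  obtain P :: "(nat \<Rightarrow> 'x \<times> 'u) measure" where P: "prob_space P"
    and sets_P: "sets P = sets (\<Pi>\<^sub>M t\<in>UNIV. count_space UNIV)"
    and law: "\<And>n. distr P (count_space UNIV) (\<lambda>\<omega>. map \<omega> [0..<n]) = measure_pmf (?L n)"
    by blast
  have "distr P (count_space UNIV) (history_upto t) = measure_pmf (history_pmf Q \<pi> \<nu> t)" for t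
  proof -
    have "distr P (count_space UNIV) (history_upto t)
       = distr (distr P (count_space UNIV) (\<lambda>\<omega>. map \<omega> [0..<Suc t])) (count_space UNIV)
           (\<lambda>l. (butlast l, fst (last l)))"
    proof (subst distr_distr)
      show "(\<lambda>\<omega>. map \<omega> [0..<Suc t]) \<in> measurable P (count_space UNIV)"
        unfolding measurable_cong_sets[OF sets_P refl] by (rule prefix_measurable)
      have "(\<lambda>l. (butlast l, fst (last l))) \<circ> (\<lambda>\<omega>. map \<omega> [0..<Suc t])
          = (history_upto t :: (nat \<Rightarrow> 'x \<times> 'u) \<Rightarrow> _)"
        by (simp add: fun_eq_iff history_upto_def state_def)
      then show "distr P (count_space UNIV) (history_upto t) = distr P (count_space UNIV)
          ((\<lambda>l. (butlast l, fst (last l))) \<circ> (\<lambda>\<omega>. map \<omega> [0..<Suc t]))"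
        by (simp only:)
    qed simp
    also have "\<dots> = measure_pmf (map_pmf (\<lambda>l. (butlast l, fst (last l))) (?L (Suc t)))"
      unfolding law map_pmf_rep_eq ..
    also have "map_pmf (\<lambda>l. (butlast l, fst (last l))) (?L (Suc t)) = history_pmf Q \<pi> \<nu> t"
      unfolding map_fst_history_pmf_Suc
      by (simp add: map_bind_pmf pmf.map_comp o_def bind_return_pmf')
    finally show ?thesis .
  qed
  then have P_ctrl: "is_controlled_measure F Q \<pi> \<nu> P"
    using P sets_P by (simp add: is_controlled_measure_iff[OF \<pi>])
  have uniq: "P1 = P2" if "is_controlled_measure F Q \<pi> \<nu> P1" "is_controlled_measure F Q \<pi> \<nu> P2" for P1 P2
  proof (rule measure_eqI_prefixes)
    have prefix: "distr P' (count_space UNIV) (\<lambda>\<omega>. map \<omega> [0..<n]) = measure_pmf (?L n)"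
      if "is_controlled_measure F Q \<pi> \<nu> P'" for P' n
    proof -
      have sets_P': "sets P' = sets (\<Pi>\<^sub>M t\<in>UNIV. count_space UNIV)"
        and law': "distr P' (count_space UNIV) (history_upto n) = measure_pmf (history_pmf Q \<pi> \<nu> n)"
        using that by (auto simp: is_controlled_measure_iff[OF \<pi>])
      have "distr P' (count_space UNIV) (\<lambda>\<omega>. map \<omega> [0..<n])
         = distr (distr P' (count_space UNIV) (history_upto n)) (count_space UNIV) fst"
        by (subst distr_distr)
           (auto simp: measurable_cong_sets[OF sets_P' refl] o_def history_upto_def[abs_def]
             intro: history_upto_measurable[unfolded history_upto_def[abs_def]])
      then show ?thesis
        by (simp add: law' map_pmf_rep_eq)
    qed
    show "distr P1 (count_space UNIV) (\<lambda>\<omega>. map \<omega> [0..<n])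
        = distr P2 (count_space UNIV) (\<lambda>\<omega>. map \<omega> [0..<n])" for n
      using that by (simp add: prefix)
  qed (use that in \<open>auto simp: is_controlled_measure_iff[OF \<pi>]\<close>)
  have "is_controlled_measure F Q \<pi> \<nu> (controlled_measure F Q \<pi> \<nu>)"
    unfolding controlled_measure_def using P_ctrl
    by (rule theI) (rule uniq[OF _ P_ctrl])
  then show "prob_space (controlled_measure F Q \<pi> \<nu>)"
    "sets (controlled_measure F Q \<pi> \<nu>) = sets (\<Pi>\<^sub>M t\<in>UNIV. count_space UNIV)"
    "distr (controlled_measure F Q \<pi> \<nu>) (count_space UNIV) (history_upto t)
        = measure_pmf (history_pmf Q \<pi> \<nu> t)"
    by (auto simp: is_controlled_measure_iff[OF \<pi>])
qed

section \<open>Countable sums and Cesaro limits\<close>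

lemma infsum_ennreal_eq_nn_integral:
  fixes f :: "'a::countable \<Rightarrow> ennreal"
  shows "(\<Sum>\<^sub>\<infinity>x. f x) = (\<integral>\<^sup>+x. f x \<partial>count_space UNIV)"
proof (rule antisym)
  have fin: "(\<integral>\<^sup>+x. f x * indicator G x \<partial>count_space UNIV) = sum f G" if "finite G" for G
    using that by (simp add: nn_integral_count_space_finite flip: nn_integral_count_space_indicator)
  have inf: "(\<Sum>\<^sub>\<infinity>x. f x) = (SUP G\<in>{G. finite G \<and> G \<subseteq> UNIV}. sum f G)"
    by (rule nonneg_infsum_complete) auto
  show "(\<Sum>\<^sub>\<infinity>x. f x) \<le> (\<integral>\<^sup>+x. f x \<partial>count_space UNIV)"
    unfolding inf
    by (intro SUP_least) (auto simp: fin[symmetric] intro!: nn_integral_mono split: split_indicator)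
  \<comment> \<open>Finite sets exhausting the countable type along \<open>to_nat\<close>; monotone
    convergence then bounds the integral by finite partial sums.\<close>
  define G where "G n = {x::'a. to_nat x < n}" for n
  have G: "finite (G n)" for n
    unfolding G_def using finite_vimageI[OF finite_lessThan inj_to_nat, of n] by (simp add: vimage_def)
  have "f x = (SUP n. f x * indicator (G n) x)" for x
  proof (rule antisym)
    show "f x \<le> (SUP n. f x * indicator (G n) x)"
      by (intro SUP_upper2[of "Suc (to_nat x)"]) (auto simp: G_def)
  qed (auto intro!: SUP_least split: split_indicator)
  then have "(\<integral>\<^sup>+x. f x \<partial>count_space UNIV) = (\<integral>\<^sup>+x. (SUP n. f x * indicator (G n) x) \<partial>count_space UNIV)"
    by simp
  also have "\<dots> = (SUP n. \<integral>\<^sup>+x. f x * indicator (G n) x \<partial>count_space UNIV)"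
    by (intro nn_integral_monotone_convergence_SUP)
       (auto simp: incseq_def le_fun_def G_def split: split_indicator)
  also have "\<dots> \<le> (\<Sum>\<^sub>\<infinity>x. f x)"
    unfolding inf using G by (auto simp: fin intro!: SUP_least SUP_upper)
  finally show "(\<integral>\<^sup>+x. f x \<partial>count_space UNIV) \<le> (\<Sum>\<^sub>\<infinity>x. f x)" .
qed

lemma infsum_mult_pmf:
  fixes f :: "'a::countable \<Rightarrow> ennreal"
  shows "(\<Sum>\<^sub>\<infinity>x. f x * ennreal (pmf \<nu> x)) = (\<integral>\<^sup>+x. f x \<partial>measure_pmf \<nu>)"
  by (simp add: infsum_ennreal_eq_nn_integral nn_integral_measure_pmf mult.commute)

text \<open>No average exceeds the supremum. Conversely, for fixed \<open>k\<close> the terms from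
  \<open>k\<close> on contribute at least \<open>(N - k) * a k / N\<close>, which tends to
  \<open>a k\<close>.\<close>

lemma limsup_average_incseq:
  fixes a :: "nat \<Rightarrow> ennreal"
  assumes a: "incseq a" and fin: "\<And>t. a t < top"
  shows "limsup (\<lambda>N. (\<Sum>t<N. a t) / of_nat N) = (SUP t. a t)"
proof (rule antisym)
  have "(\<Sum>t<N. a t) / of_nat N \<le> (SUP t. a t)" for N
  proof (cases "N = 0")
    case False
    have "(\<Sum>t<N. a t) \<le> of_nat N * (SUP t. a t)"
      using sum_bounded_above[of "{..<N}" a "SUP t. a t"] by (auto intro: SUP_upper)
    then have "(\<Sum>t<N. a t) / of_nat N \<le> of_nat N * (SUP t. a t) / of_nat N"
      by (rule divide_right_mono_ennreal)
    also have "\<dots> = (SUP t. a t)"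
      unfolding mult.commute[of "of_nat N"] using False by (intro ennreal_mult_divide_eq) auto
    finally show ?thesis .
  qed simp
  then show "limsup (\<lambda>N. (\<Sum>t<N. a t) / of_nat N) \<le> (SUP t. a t)"
    by (intro Limsup_bounded) simp
  show "(SUP t. a t) \<le> limsup (\<lambda>N. (\<Sum>t<N. a t) / of_nat N)"
  proof (rule SUP_least)
    fix k
    have "(\<lambda>N. 1 - real k / real N) \<longlonglongrightarrow> 1 - 0"
      by (intro tendsto_diff tendsto_const lim_const_over_n)
    then have "(\<lambda>N. a k * ennreal (1 - real k / real N)) \<longlonglongrightarrow> a k * ennreal 1"
      using fin[of k] by (intro ennreal_tendsto_cmult tendsto_ennrealI) auto
    then have "a k = limsup (\<lambda>N. a k * ennreal (1 - real k / real N))"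
      by (simp add: lim_imp_Limsup)
    also have "\<dots> \<le> limsup (\<lambda>N. (\<Sum>t<N. a t) / of_nat N)"
    proof (rule Limsup_mono, rule eventually_sequentiallyI[of "Suc k"])
      fix N assume N: "Suc k \<le> N"
      have "of_nat (N - k) * a k = (\<Sum>t\<in>{k..<N}. a k)" by simp
      also have "\<dots> \<le> (\<Sum>t\<in>{k..<N}. a t)"
        by (intro sum_mono) (auto intro: incseqD[OF a])
      also have "\<dots> \<le> (\<Sum>t<N. a t)"
        by (intro sum_mono2) auto
      finally have le: "of_nat (N - k) * a k / of_nat N \<le> (\<Sum>t<N. a t) / of_nat N"
        by (rule divide_right_mono_ennreal)
      have "1 - real k / real N = real (N - k) / real N"
        using N by (simp add: of_nat_diff field_simps)
      then have "a k * ennreal (1 - real k / real N) = of_nat (N - k) * a k / of_nat N"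
        using N by (simp add: divide_ennreal[symmetric] ennreal_of_nat_eq_real_of_nat ennreal_times_divide mult.commute)
      with le show "a k * ennreal (1 - real k / real N) \<le> (\<Sum>t<N. a t) / of_nat N" by simp
    qed
    finally show "a k \<le> limsup (\<lambda>N. (\<Sum>t<N. a t) / of_nat N)" .
  qed
qed

section \<open>Mixtures of initial states, and stopping at the first visit to a set\<close>

lemma history_pmf_mixture:
  "history_pmf Q \<pi> \<nu> t = bind_pmf \<nu> (\<lambda>x. history_pmf Q \<pi> (return_pmf x) t)"
proof (induction t)
  case 0
  show ?case by (simp add: map_pmf_def bind_return_pmf)
next
  case (Suc t)
  show ?case by (subst history_pmf.simps, subst Suc) (simp add: bind_assoc_pmf)
qed

text \<open>After a visit to \<open>C\<close> everything but the state first hit is forgotten: this makes the stopped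
  process a chain of its own, whose transitions involve \<open>Q\<close> only outside \<open>C\<close>.\<close>

definition stopped_history :: "'x set \<Rightarrow> ('x, 'u) history \<Rightarrow> ('x, 'u) history" where
  "stopped_history C h = (case find (\<lambda>p. fst p \<in> C) (fst h) of None \<Rightarrow> h | Some p \<Rightarrow> ([], fst p))"

definition stopped_step ::
  "'x set \<Rightarrow> ('x \<Rightarrow> 'u \<Rightarrow> 'x pmf) \<Rightarrow> ('x, 'u) policy \<Rightarrow> nat \<Rightarrow> ('x, 'u) history \<Rightarrow> ('x, 'u) history pmf" where
  "stopped_step C Q \<pi> t h = (if snd h \<in> C then return_pmf ([], snd h) else history_step Q \<pi> t h)"

lemma find_append: "find P (xs @ ys) = (case find P xs of None \<Rightarrow> find P ys | Some x \<Rightarrow> Some x)"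
  by (induction xs) auto

lemma stopped_history_cases:
  obtains "stopped_history C h = h" "find (\<lambda>p. fst p \<in> C) (fst h) = None"
  | p where "stopped_history C h = ([], fst p)" "fst p \<in> C" "find (\<lambda>p. fst p \<in> C) (fst h) = Some p"
proof (cases "find (\<lambda>p. fst p \<in> C) (fst h)")
  case None
  then show thesis using that(1) by (simp add: stopped_history_def)
next
  case (Some p)
  then have "fst p \<in> C" by (auto simp: find_Some_iff)
  with Some show thesis using that(2) by (simp add: stopped_history_def)
qed

text \<open>\<open>find\<close> sees only completed pairs. A first visit at the current state leaves
  the history intact; the collapse comes one step later, with the same recorded state.\<close>

lemma stopped_history_extend:
  "stopped_history C (fst h @ [(snd h, u)], y) =
    (if snd (stopped_history C h) \<in> C then ([], snd (stopped_history C h))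
     else (fst h @ [(snd h, u)], y))"
  by (cases C h rule: stopped_history_cases)
     (auto simp: stopped_history_def find_append)

text \<open>Before a visit the map changes nothing, so the policy still has its full history; once a
  visit has occurred, the image is constant whatever is drawn. Either way the image of a step
  depends on the history only through its own image.\<close>

lemma map_stopped_history_step:
  "map_pmf (stopped_history C) (history_step Q \<pi> t h) = stopped_step C Q \<pi> t (stopped_history C h)"
proof (cases "snd (stopped_history C h) \<in> C")
  case True
  then show ?thesis
    by (simp add: history_step_def map_bind_pmf pmf.map_comp o_def stopped_history_extend stopped_step_def
        bind_pmf_const)
next
  case False
  then have "stopped_history C h = h"
    by (cases C h rule: stopped_history_cases) auto
  with False show ?thesis
    by (simp add: history_step_def map_bind_pmf pmf.map_comp o_def stopped_history_extend stopped_step_def)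
qed

lemma map_stopped_history_pmf_Suc:
  "map_pmf (stopped_history C) (history_pmf Q \<pi> \<nu> (Suc t))
    = bind_pmf (map_pmf (stopped_history C) (history_pmf Q \<pi> \<nu> t)) (stopped_step C Q \<pi> t)"
  by (simp add: map_bind_pmf map_stopped_history_step bind_map_pmf)

text \<open>The stopped recursion consults the kernel only at histories that have not met
  \<open>C\<close>. At reachable ones the policy plays only feasible actions, and there the kernels
  agree.\<close>

lemma map_stopped_history_pmf_cong:
  assumes \<pi>: "\<pi> \<in> policies F"
    and eq: "\<And>x u. u \<in> F x \<Longrightarrow> x \<notin> C \<Longrightarrow> Q' x u = Q x u"
  shows "map_pmf (stopped_history C) (history_pmf Q \<pi> \<nu> t)
    = map_pmf (stopped_history C) (history_pmf Q' \<pi> \<nu> t)"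
proof (induction t)
  case (Suc t)
  have "stopped_step C Q \<pi> t (stopped_history C h) = stopped_step C Q' \<pi> t (stopped_history C h)"
    if h: "h \<in> set_pmf (history_pmf Q' \<pi> \<nu> t)" for h
  proof (cases C h rule: stopped_history_cases)
    case 1
    have "set_pmf (\<pi> t h) \<subseteq> F (snd h)"
      using policies_set_pmf[OF \<pi>] set_history_pmf[OF \<pi>] h by blast
    then have "history_step Q \<pi> t h = history_step Q' \<pi> t h" if "snd h \<notin> C"
      unfolding history_step_def using that eq by (intro bind_pmf_cong) auto
    with 1 show ?thesis by (simp add: stopped_step_def)
  qed (simp add: stopped_step_def)
  then show ?case
    unfolding map_stopped_history_pmf_Suc Suc unfolding bind_map_pmf
    by (intro bind_pmf_cong refl)
qed simp

section \<open>Occupation of \<open>A\<close> under the modified kernel\<close>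

lemma modified_kernelD:
  assumes "modified_kernel F A B Q Q'" "u \<in> F x"
  shows "x \<in> A \<Longrightarrow> set_pmf (Q' x u) \<subseteq> A" "x \<in> B \<Longrightarrow> set_pmf (Q' x u) \<subseteq> B"
    "x \<notin> A \<union> B \<Longrightarrow> Q' x u = Q x u"
  using assms
  by (auto simp: modified_kernel_def feasible_pairs_def measure_pmf.prob_eq_1 AE_measure_pmf_iff)

lemma set_history_pmf_SucE:
  assumes \<pi>: "\<pi> \<in> policies F" and "h' \<in> set_pmf (history_pmf Q \<pi> \<nu> (Suc t))"
  obtains h u y where "h \<in> set_pmf (history_pmf Q \<pi> \<nu> t)" "u \<in> F (snd h)"
    "y \<in> set_pmf (Q (snd h) u)" "h' = (fst h @ [(snd h, u)], y)"
proof -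
  from assms(2) obtain h u y where *: "h \<in> set_pmf (history_pmf Q \<pi> \<nu> t)" "u \<in> set_pmf (\<pi> t h)"
    "y \<in> set_pmf (Q (snd h) u)" "h' = (fst h @ [(snd h, u)], y)"
    by (auto simp: history_step_def)
  moreover have "u \<in> F (snd h)"
    using policies_set_pmf[OF \<pi>] set_history_pmf[OF \<pi>] * by blast
  ultimately show thesis using that by blast
qed

text \<open>The current state and the recorded one may differ, because \<open>Q'\<close> can still
  move inside \<open>A\<close> and inside \<open>B\<close>, but they belong to the same of these
  sets. Tracking \<open>A\<close> and \<open>B\<close> together makes the induction close:
  absorption keeps the process in one of them and disjointness excludes the other.\<close>

lemma modified_stopped_history:
  assumes \<pi>: "\<pi> \<in> policies F" and AB: "A \<inter> B = {}" and Q': "modified_kernel F A B Q Q'"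
    and h: "h \<in> set_pmf (history_pmf Q' \<pi> \<nu> t)"
  shows "(snd (stopped_history (A \<union> B) h) \<in> A \<longleftrightarrow> snd h \<in> A) \<and>
    (snd (stopped_history (A \<union> B) h) \<in> B \<longleftrightarrow> snd h \<in> B)"
  using h
proof (induction t arbitrary: h)
  case 0
  then show ?case by (auto simp: stopped_history_def)
next
  case (Suc t)
  from Suc.prems obtain h1 u y where h1: "h1 \<in> set_pmf (history_pmf Q' \<pi> \<nu> t)" "u \<in> F (snd h1)"
    "y \<in> set_pmf (Q' (snd h1) u)" "h = (fst h1 @ [(snd h1, u)], y)"
    by (rule set_history_pmf_SucE[OF \<pi>])
  show ?case
    using Suc.IH[OF h1(1)] modified_kernelD(1,2)[OF Q' h1(2)] h1(3) AB
    unfolding h1(4) stopped_history_extend by auto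
qed

definition occupation ::
  "'x set \<Rightarrow> ('x \<Rightarrow> 'u \<Rightarrow> 'x pmf) \<Rightarrow> ('x, 'u) policy \<Rightarrow> 'x pmf \<Rightarrow> nat \<Rightarrow> ennreal" where
  "occupation A Q \<pi> \<nu> t = emeasure (measure_pmf (history_pmf Q \<pi> \<nu> t)) (snd -` A)"

lemma occupation_le_1: "occupation A Q \<pi> \<nu> t \<le> 1"
  by (simp add: occupation_def measure_pmf.emeasure_le_1)

text \<open>This is the passage from \<open>Q\<close> to \<open>Q'\<close>: the stopped history has
  the same law under both, and under \<open>Q'\<close> its recorded state can be replaced by the
  current one. On trajectories the left side is the probability that \<open>A\<close> has been
  reached by time \<open>t\<close> with \<open>B\<close> avoided before.\<close>

lemma emeasure_stopped_history:
  assumes \<pi>: "\<pi> \<in> policies F" and AB: "A \<inter> B = {}" and Q': "modified_kernel F A B Q Q'"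
  shows "emeasure (measure_pmf (history_pmf Q \<pi> \<nu> t)) {h. snd (stopped_history (A \<union> B) h) \<in> A}
    = occupation A Q' \<pi> \<nu> t"
proof -
  let ?s = "stopped_history (A \<union> B)"
  have "emeasure (measure_pmf (history_pmf Q \<pi> \<nu> t)) {h. snd (?s h) \<in> A}
    = emeasure (measure_pmf (map_pmf ?s (history_pmf Q \<pi> \<nu> t))) (snd -` A)"
    by (simp add: vimage_def)
  also have "map_pmf ?s (history_pmf Q \<pi> \<nu> t) = map_pmf ?s (history_pmf Q' \<pi> \<nu> t)"
    using modified_kernelD(3)[OF Q'] by (intro map_stopped_history_pmf_cong[OF \<pi>]) auto
  also have "emeasure (measure_pmf \<dots>) (snd -` A)
      = emeasure (measure_pmf (history_pmf Q' \<pi> \<nu> t)) {h. snd (?s h) \<in> A}"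
    by (simp add: vimage_def)
  also have "\<dots> = occupation A Q' \<pi> \<nu> t"
    unfolding occupation_def using modified_stopped_history[OF \<pi> AB Q']
    by (intro emeasure_eq_AE) (auto simp: AE_measure_pmf_iff)
  finally show ?thesis .
qed

lemma incseq_occupation:
  assumes \<pi>: "\<pi> \<in> policies F" and Q': "modified_kernel F A B Q Q'"
  shows "incseq (occupation A Q' \<pi> \<nu>)"
proof (rule incseq_SucI)
  fix t
  have "occupation A Q' \<pi> \<nu> t = (\<integral>\<^sup>+h. indicator (snd -` A) h \<partial>measure_pmf (history_pmf Q' \<pi> \<nu> t))"
    by (simp add: occupation_def)
  also have "\<dots> \<le> (\<integral>\<^sup>+h. emeasure (measure_pmf (history_step Q' \<pi> t h)) (snd -` A)
      \<partial>measure_pmf (history_pmf Q' \<pi> \<nu> t))"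
  proof (rule nn_integral_mono_AE, unfold AE_measure_pmf_iff, rule ballI)
    fix h assume h: "h \<in> set_pmf (history_pmf Q' \<pi> \<nu> t)"
    have "emeasure (measure_pmf (history_step Q' \<pi> t h)) (snd -` A) = 1" if "snd h \<in> A"
    proof -
      have "set_pmf (\<pi> t h) \<subseteq> F (snd h)"
        using policies_set_pmf[OF \<pi>] set_history_pmf[OF \<pi>] h by blast
      with modified_kernelD(1)[OF Q' _ that] have "set_pmf (history_step Q' \<pi> t h) \<subseteq> snd -` A"
        by (fastforce simp: history_step_def)
      then show ?thesis
        by (simp add: measure_pmf.emeasure_eq_measure measure_pmf.prob_eq_1 AE_measure_pmf_iff subset_eq)
    qed
    then show "indicator (snd -` A) h \<le> emeasure (measure_pmf (history_step Q' \<pi> t h)) (snd -` A)"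
      by (auto split: split_indicator)
  qed
  also have "\<dots> = occupation A Q' \<pi> \<nu> (Suc t)"
    by (simp add: occupation_def emeasure_bind_pmf)
  finally show "occupation A Q' \<pi> \<nu> t \<le> occupation A Q' \<pi> \<nu> (Suc t)" .
qed

text \<open>At each fixed \<open>t\<close> the occupation is linear in the initial law; growth in
  \<open>t\<close> lets the supremum pass under the integral.\<close>

lemma SUP_occupation_mixture:
  assumes \<pi>: "\<pi> \<in> policies F" and Q': "modified_kernel F A B Q Q'"
  shows "(SUP t. occupation A Q' \<pi> \<nu> t)
    = (\<integral>\<^sup>+x. (SUP t. occupation A Q' \<pi> (return_pmf x) t) \<partial>measure_pmf \<nu>)"
proof -
  have "occupation A Q' \<pi> \<nu> t = (\<integral>\<^sup>+x. occupation A Q' \<pi> (return_pmf x) t \<partial>measure_pmf \<nu>)" for t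
    unfolding occupation_def by (subst history_pmf_mixture) (simp add: emeasure_bind_pmf)
  then show ?thesis
    using incseq_occupation[OF \<pi> Q']
    by (subst nn_integral_monotone_convergence_SUP) (auto simp: incseq_def le_fun_def)
qed

section \<open>Replacing a policy by a Markov policy\<close>

definition state_action_pmf ::
  "('x \<Rightarrow> 'u \<Rightarrow> 'x pmf) \<Rightarrow> ('x, 'u) policy \<Rightarrow> 'x pmf \<Rightarrow> nat \<Rightarrow> ('x \<times> 'u) pmf" where
  "state_action_pmf Q \<pi> \<nu> t =
    bind_pmf (history_pmf Q \<pi> \<nu> t) (\<lambda>h. map_pmf (Pair (snd h)) (\<pi> t h))"

text \<open>Conditioning is possible only at states taken with positive probability at time
  \<open>t\<close>; elsewhere some feasible action is fixed. The result depends on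
  \<open>\<nu>\<close> as well as on \<open>\<pi>\<close>.\<close>

definition markov_version ::
  "('x \<Rightarrow> 'u set) \<Rightarrow> ('x \<Rightarrow> 'u \<Rightarrow> 'x pmf) \<Rightarrow> 'x pmf \<Rightarrow> ('x, 'u) policy \<Rightarrow> ('x, 'u) policy" where
  "markov_version F Q \<nu> \<pi> t h =
    (if snd h \<in> fst ` set_pmf (state_action_pmf Q \<pi> \<nu> t)
     then map_pmf snd (cond_pmf (state_action_pmf Q \<pi> \<nu> t) {p. fst p = snd h})
     else return_pmf (SOME u. u \<in> F (snd h)))"

lemma markov_version_in_markov_policies:
  assumes \<pi>: "\<pi> \<in> policies F" and ne: "\<And>x. F x \<noteq> {}"
  shows "markov_version F Q \<nu> \<pi> \<in> markov_policies F"
proof -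
  have feas: "snd p \<in> F (fst p)" if "p \<in> set_pmf (state_action_pmf Q \<pi> \<nu> t)" for p t
    using that policies_set_pmf[OF \<pi>] set_history_pmf[OF \<pi>, of Q \<nu> t]
    by (fastforce simp: state_action_pmf_def)
  have "set_pmf (markov_version F Q \<nu> \<pi> t h) \<subseteq> F (snd h)" for t h
  proof (cases "snd h \<in> fst ` set_pmf (state_action_pmf Q \<pi> \<nu> t)")
    case True
    then have "set_pmf (state_action_pmf Q \<pi> \<nu> t) \<inter> {p. fst p = snd h} \<noteq> {}" by auto
    with True feas show ?thesis by (auto simp: markov_version_def)
  next
    case False
    then show ?thesis
      using ne[of "snd h"] by (simp add: markov_version_def some_in_eq)
  qed
  then have "markov_version F Q \<nu> \<pi> \<in> policies F"
    by (simp add: policies_def measure_pmf.prob_eq_1 AE_measure_pmf_iff subset_eq)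
  then show ?thesis
    by (simp add: markov_policies_def markov_version_def)
qed

lemma bind_cond_fst_pmf:
  fixes p :: "('a \<times> 'b) pmf"
  shows "bind_pmf (map_pmf fst p) (\<lambda>x. cond_pmf p {y. fst y = x}) = p"
proof (rule bind_cond_pmf_cancel)
  fix x and y :: "'a \<times> 'b" assume "fst y = x"
  then show "measure_pmf.prob p {y. fst y = x} = measure_pmf.prob (map_pmf fst p) {x. fst y = x}"
    by (simp add: vimage_def eq_commute)
qed auto

lemma map_snd_history_pmf_Suc:
  "map_pmf snd (history_pmf Q \<pi> \<nu> (Suc t)) = bind_pmf (state_action_pmf Q \<pi> \<nu> t) (\<lambda>(x, u). Q x u)"
  by (simp add: state_action_pmf_def history_step_def map_bind_pmf pmf.map_comp o_def
      bind_assoc_pmf bind_map_pmf pmf.map_ident)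

text \<open>Laws of whole histories may change, so the induction carries only the law of the current
  state. With it, the conditional action law restores the joint law of state and action, and this
  alone determines the law of the next state.\<close>

lemma map_snd_history_pmf_markov_version:
  "map_pmf snd (history_pmf Q (markov_version F Q \<nu> \<pi>) \<nu> t) = map_pmf snd (history_pmf Q \<pi> \<nu> t)"
proof (induction t)
  case (Suc t)
  let ?J = "state_action_pmf Q \<pi> \<nu> t"
  have J: "map_pmf fst ?J = map_pmf snd (history_pmf Q \<pi> \<nu> t)"
    by (simp add: state_action_pmf_def map_bind_pmf pmf.map_comp o_def) (simp add: map_pmf_def)
  \<comment> \<open>The Markov version reads only the last state, so \<open>([], x)\<close> stands
    for any history ending in \<open>x\<close>.\<close>
  have "state_action_pmf Q (markov_version F Q \<nu> \<pi>) \<nu> t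
     = bind_pmf (map_pmf snd (history_pmf Q (markov_version F Q \<nu> \<pi>) \<nu> t))
         (\<lambda>x. map_pmf (Pair x) (markov_version F Q \<nu> \<pi> t ([], x)))"
    unfolding state_action_pmf_def[of Q "markov_version F Q \<nu> \<pi>"] bind_map_pmf
    by (intro bind_pmf_cong refl) (simp add: markov_version_def)
  also have "\<dots> = bind_pmf (map_pmf fst ?J) (\<lambda>x. map_pmf (Pair x) (markov_version F Q \<nu> \<pi> t ([], x)))"
    by (simp add: Suc J)
  also have "\<dots> = bind_pmf (map_pmf fst ?J) (\<lambda>x. cond_pmf ?J {y. fst y = x})"
  proof (rule bind_pmf_cong[OF refl])
    fix x assume x: "x \<in> set_pmf (map_pmf fst ?J)"
    then have "set_pmf ?J \<inter> {y. fst y = x} \<noteq> {}" by auto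
    then have "map_pmf (\<lambda>p. (x, snd p)) (cond_pmf ?J {y. fst y = x})
      = map_pmf (\<lambda>p. p) (cond_pmf ?J {y. fst y = x})"
      by (intro map_pmf_cong refl) auto
    with x show "map_pmf (Pair x) (markov_version F Q \<nu> \<pi> t ([], x)) = cond_pmf ?J {y. fst y = x}"
      by (simp add: markov_version_def pmf.map_comp o_def pmf.map_ident)
  qed
  also have "\<dots> = ?J" by (rule bind_cond_fst_pmf)
  finally show ?case by (simp only: map_snd_history_pmf_Suc)
qed simp

lemma occupation_markov_version:
  "occupation A Q (markov_version F Q \<nu> \<pi>) \<nu> t = occupation A Q \<pi> \<nu> t"
  using map_snd_history_pmf_markov_version[of Q F \<nu> \<pi> t]
  unfolding occupation_def by (metis emeasure_map_pmf)

section \<open>Gluing policies along the initial state\<close>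

definition first_state :: "('x, 'u) history \<Rightarrow> 'x" where
  "first_state h = (case fst h of [] \<Rightarrow> snd h | p # _ \<Rightarrow> fst p)"

lemma first_state_extend: "first_state (l @ [(x, u)], y) = first_state (l, x)"
  by (simp add: first_state_def split: list.split)

text \<open>Extending a history preserves its first state, so on histories started at
  \<open>x\<close> the glued policy decides as \<open>\<pi> x\<close> does.\<close>

lemma history_pmf_glued:
  "history_pmf Q (\<lambda>t h. \<pi> (first_state h) t h) (return_pmf x) t = history_pmf Q (\<pi> x) (return_pmf x) t"
proof -
  have first: "first_state h = x" if "h \<in> set_pmf (history_pmf Q (\<pi> x) (return_pmf x) t)" for h t
    using that
    by (induction t arbitrary: h) (auto simp: history_step_def first_state_extend, simp add: first_state_def)
  show ?thesis
  proof (induction t)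
    case (Suc t)
    show ?case
      unfolding history_pmf.simps Suc
      by (intro bind_pmf_cong refl) (simp add: history_step_def first)
  qed simp
qed

lemma glued_in_policies:
  assumes "\<And>x. \<pi> x \<in> policies F"
  shows "(\<lambda>t h. \<pi> (first_state h) t h) \<in> policies F"
  using assms by (auto simp: policies_def)

section \<open>Reaching \<open>A\<close> before \<open>B\<close> along a trajectory\<close>

lemma hitting_time_le_iff: "hitting_time A \<omega> \<le> enat i \<longleftrightarrow> (\<exists>j\<le>i. state j \<omega> \<in> A)"
proof
  assume le: "hitting_time A \<omega> \<le> enat i"
  let ?S = "{enat t |t. state t \<omega> \<in> A}"
  have "?S \<noteq> {}"
  proof
    assume "?S = {}"
    then have "hitting_time A \<omega> = \<infinity>"
      unfolding hitting_time_def by (simp only: Inf_empty top_enat_def)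
    with le show False by simp
  qed
  then obtain e where "e \<in> ?S" by blast
  then have "hitting_time A \<omega> \<in> ?S"
    unfolding hitting_time_def by (rule wellorder_InfI)
  with le show "\<exists>j\<le>i. state j \<omega> \<in> A" by auto
next
  assume "\<exists>j\<le>i. state j \<omega> \<in> A"
  then obtain j where "j \<le> i" "state j \<omega> \<in> A" by blast
  then show "hitting_time A \<omega> \<le> enat i"
    unfolding hitting_time_def by (intro Inf_lower2[of "enat j"]) auto
qed

text \<open>The comparison of two infima becomes a countable union of conditions on finitely many
  states, which finite histories can express.\<close>

lemma hitting_time_less_iff:
  "hitting_time A \<omega> < hitting_time B \<omega> \<and> hitting_time A \<omega> < \<infinity> \<longleftrightarrow>
    (\<exists>i. state i \<omega> \<in> A \<and> (\<forall>j\<le>i. state j \<omega> \<notin> B))"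
proof
  assume less: "hitting_time A \<omega> < hitting_time B \<omega> \<and> hitting_time A \<omega> < \<infinity>"
  then obtain i where i: "hitting_time A \<omega> = enat i" by (auto simp: less_infinityE)
  then obtain k where k: "k \<le> i" "state k \<omega> \<in> A"
    using hitting_time_le_iff[of A \<omega> i] by auto
  have "\<not> hitting_time B \<omega> \<le> enat i" using less i by simp
  with k show "\<exists>i. state i \<omega> \<in> A \<and> (\<forall>j\<le>i. state j \<omega> \<notin> B)"
    unfolding hitting_time_le_iff by (meson le_trans)
next
  assume "\<exists>i. state i \<omega> \<in> A \<and> (\<forall>j\<le>i. state j \<omega> \<notin> B)"
  then obtain i where "hitting_time A \<omega> \<le> enat i" "\<not> hitting_time B \<omega> \<le> enat i"
    unfolding hitting_time_le_iff by blast
  then show "hitting_time A \<omega> < hitting_time B \<omega> \<and> hitting_time A \<omega> < \<infinity>"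
    by (meson enat_ord_code(4) le_less_trans not_le)
qed

lemma stopped_history_upto_before:
  assumes "\<And>j. j < t \<Longrightarrow> state j \<omega> \<notin> C"
  shows "stopped_history C (history_upto t \<omega>) = history_upto t \<omega>"
proof -
  have "find (\<lambda>p. fst p \<in> C) (fst (history_upto t \<omega>)) = None"
    using assms by (auto simp: find_None_iff history_upto_def state_def)
  then show ?thesis by (simp add: stopped_history_def)
qed

lemma stopped_history_upto_after:
  assumes "\<And>j. j < i \<Longrightarrow> state j \<omega> \<notin> C" "state i \<omega> \<in> C" "i \<le> t"
  shows "snd (stopped_history C (history_upto t \<omega>)) = state i \<omega>"
  using \<open>i \<le> t\<close>
proof (induction t rule: dec_induct)
  \<comment> \<open>At \<open>t = i\<close> the list holds only earlier states, so nothing has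
    collapsed yet.\<close>
  case base
  show ?case
    using assms(1) by (subst stopped_history_upto_before) (auto simp: history_upto_def)
next
  case (step t)
  with assms(2) show ?case
    by (simp add: history_upto_Suc stopped_history_extend)
qed

text \<open>The first entrance \<open>i\<close> into \<open>A \<union> B\<close> decides: its state
  is the one recorded, and by disjointness it lies in \<open>A\<close> exactly if \<open>A\<close>
  is reached with \<open>B\<close> avoided. Without an entrance by time \<open>t\<close> both sides
  fail.\<close>

lemma stopped_history_upto_iff:
  assumes AB: "A \<inter> B = {}"
  shows "snd (stopped_history (A \<union> B) (history_upto t \<omega>)) \<in> A \<longleftrightarrow>
    (\<exists>i\<le>t. state i \<omega> \<in> A \<and> (\<forall>j\<le>i. state j \<omega> \<notin> B))"
proof (cases "\<exists>i\<le>t. state i \<omega> \<in> A \<union> B")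
  case True
  define i where "i = (LEAST i. state i \<omega> \<in> A \<union> B)"
  from True obtain k where k: "k \<le> t" "state k \<omega> \<in> A \<union> B" by blast
  have i: "i \<le> t" "state i \<omega> \<in> A \<union> B"
    unfolding i_def using k(1) Least_le[of "\<lambda>i. state i \<omega> \<in> A \<union> B", OF k(2)]
      LeastI[of "\<lambda>i. state i \<omega> \<in> A \<union> B", OF k(2)] by linarith+
  have before: "state j \<omega> \<notin> A \<union> B" if "j < i" for j
    using not_less_Least[of j "\<lambda>i. state i \<omega> \<in> A \<union> B"] that unfolding i_def by blast
  have "snd (stopped_history (A \<union> B) (history_upto t \<omega>)) = state i \<omega>"
    using before i(2,1) by (rule stopped_history_upto_after)
  moreover have "state i \<omega> \<in> A \<longleftrightarrow> (\<exists>i\<le>t. state i \<omega> \<in> A \<and> (\<forall>j\<le>i. state j \<omega> \<notin> B))"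
  proof
    assume "state i \<omega> \<in> A"
    with before AB have "\<forall>j\<le>i. state j \<omega> \<notin> B"
      by (auto simp: le_less)
    with \<open>state i \<omega> \<in> A\<close> i(1) show "\<exists>i\<le>t. state i \<omega> \<in> A \<and> (\<forall>j\<le>i. state j \<omega> \<notin> B)"
      by blast
  next
    assume "\<exists>i\<le>t. state i \<omega> \<in> A \<and> (\<forall>j\<le>i. state j \<omega> \<notin> B)"
    then obtain k where k: "state k \<omega> \<in> A" "\<forall>j\<le>k. state j \<omega> \<notin> B" by blast
    \<comment> \<open>A visit to \<open>A\<close> cannot precede the first entrance, so
      \<open>B\<close> is avoided at time \<open>i\<close> as well.\<close>
    then have "i \<le> k" using before[of k] by fastforce
    with k i(2) show "state i \<omega> \<in> A" by blast
  qed
  ultimately show ?thesis by simp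
next
  case False
  then have "stopped_history (A \<union> B) (history_upto t \<omega>) = history_upto t \<omega>"
    by (intro stopped_history_upto_before) auto
  with False show ?thesis by (auto simp: history_upto_def)
qed

section \<open>Reach probabilities and averages as limits of occupations\<close>

lemma emeasure_history_upto:
  fixes F :: "'x::countable \<Rightarrow> 'u::countable set"
  assumes \<pi>: "\<pi> \<in> policies F"
  shows "emeasure (controlled_measure F Q \<pi> \<nu>)
      {\<omega> \<in> space (controlled_measure F Q \<pi> \<nu>). history_upto t \<omega> \<in> S}
    = emeasure (measure_pmf (history_pmf Q \<pi> \<nu> t)) S"
  unfolding distr_controlled_measure[OF \<pi>, symmetric]
proof (subst emeasure_distr)
  show "history_upto t \<in> measurable (controlled_measure F Q \<pi> \<nu>) (count_space UNIV)"
    unfolding measurable_cong_sets[OF sets_controlled_measure[OF \<pi>] refl]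
    by (rule history_upto_measurable)
qed (simp_all add: vimage_def Int_def conj_commute)

text \<open>The event is the increasing union of the events that success has occurred by time
  \<open>t\<close>, each of which concerns a stopped history; continuity from below does the
  rest.\<close>

lemma reach_probability_eq:
  fixes F :: "'x::countable \<Rightarrow> 'u::countable set"
  assumes \<pi>: "\<pi> \<in> policies F" and AB: "A \<inter> B = {}" and Q': "modified_kernel F A B Q Q'"
  shows "emeasure (controlled_measure F Q \<pi> \<nu>)
      {\<omega> \<in> space (controlled_measure F Q \<pi> \<nu>).
        hitting_time A \<omega> < hitting_time B \<omega> \<and> hitting_time A \<omega> < \<infinity>}
    = (SUP t. occupation A Q' \<pi> \<nu> t)"
proof -
  let ?P = "controlled_measure F Q \<pi> \<nu>"
  let ?E = "\<lambda>t. {\<omega> \<in> space ?P. history_upto t \<omega> \<in> {h. snd (stopped_history (A \<union> B) h) \<in> A}}"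
  have meas: "?E t \<in> sets ?P" for t
  proof -
    have "history_upto t \<in> measurable ?P (count_space UNIV)"
      by (simp add: measurable_cong_sets[OF sets_controlled_measure[OF \<pi>] refl])
    from measurable_sets[OF this, of "{h. snd (stopped_history (A \<union> B) h) \<in> A}"]
    show ?thesis by (simp add: vimage_def Int_def conj_commute)
  qed
  have "{\<omega> \<in> space ?P. hitting_time A \<omega> < hitting_time B \<omega> \<and> hitting_time A \<omega> < \<infinity>} = (\<Union>t. ?E t)"
    unfolding hitting_time_less_iff by (auto simp: stopped_history_upto_iff[OF AB])
  also have "emeasure ?P \<dots> = (SUP t. emeasure ?P (?E t))"
  proof (rule SUP_emeasure_incseq[symmetric])
    show "incseq ?E"
      unfolding incseq_def mem_Collect_eq stopped_history_upto_iff[OF AB] by (blast intro: le_trans)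
  qed (use meas in blast)
  finally show ?thesis
    unfolding emeasure_history_upto[OF \<pi>] emeasure_stopped_history[OF \<pi> AB Q'] .
qed

lemma average_occupation_eq:
  fixes F :: "'x::countable \<Rightarrow> 'u::countable set"
  assumes \<pi>: "\<pi> \<in> policies F" and Q': "modified_kernel F A B Q Q'"
  shows "average_occupation F A Q' \<pi> x = (SUP t. occupation A Q' \<pi> (return_pmf x) t)"
proof -
  let ?P = "controlled_measure F Q' \<pi> (return_pmf x)"
  have [measurable]: "state t \<in> measurable ?P (count_space UNIV)" for t
    unfolding measurable_cong_sets[OF sets_controlled_measure[OF \<pi>] refl] state_def
    by (rule measurable_compose[OF measurable_component_singleton]) auto
  have "(\<integral>\<^sup>+\<omega>. indicator A (state t \<omega>) \<partial>?P) = occupation A Q' \<pi> (return_pmf x) t" for t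
  proof -
    have "(\<integral>\<^sup>+\<omega>. indicator A (state t \<omega>) \<partial>?P)
        = (\<integral>\<^sup>+\<omega>. indicator {\<omega> \<in> space ?P. history_upto t \<omega> \<in> snd -` A} \<omega> \<partial>?P)"
      by (intro nn_integral_cong) (auto simp: history_upto_def split: split_indicator)
    also have "\<dots> = emeasure ?P {\<omega> \<in> space ?P. history_upto t \<omega> \<in> snd -` A}"
    proof (rule nn_integral_indicator)
      have "{\<omega> \<in> space ?P. state t \<omega> \<in> A} \<in> sets ?P" by measurable
      then show "{\<omega> \<in> space ?P. history_upto t \<omega> \<in> snd -` A} \<in> sets ?P"
        by (simp add: history_upto_def)
    qed
    finally show ?thesis
      unfolding emeasure_history_upto[OF \<pi>] occupation_def .
  qed
  then have "average_occupation F A Q' \<pi> x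
      = limsup (\<lambda>N. (\<Sum>t<N. occupation A Q' \<pi> (return_pmf x) t) / of_nat N)"
    unfolding average_occupation_def by (simp add: nn_integral_sum)
  also have "\<dots> = (SUP t. occupation A Q' \<pi> (return_pmf x) t)"
    by (intro limsup_average_incseq incseq_occupation[OF \<pi> Q'] le_less_trans[OF occupation_le_1]) simp
  finally show ?thesis .
qed

theorem theorem17:
  fixes F :: "'x::countable \<Rightarrow> 'u::countable set"
    and Q Q' :: "'x \<Rightarrow> 'u \<Rightarrow> 'x pmf"
    and A B :: "'x set"
    and \<nu> :: "'x pmf"
  assumes "A \<inter> B = {}"
    and "modified_kernel F A B Q Q'"
  shows "(\<Squnion>\<pi>\<in>policies F. emeasure (controlled_measure F Q \<pi> \<nu>)
            {\<omega> \<in> space (controlled_measure F Q \<pi> \<nu>).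
              hitting_time A \<omega> < hitting_time B \<omega> \<and> hitting_time A \<omega> < \<infinity>})
          = (\<Squnion>\<pi>\<in>markov_policies F. \<Sum>\<^sub>\<infinity>x. average_occupation F A Q' \<pi> x * ennreal (pmf \<nu> x))
       \<and> (\<Squnion>\<pi>\<in>markov_policies F. \<Sum>\<^sub>\<infinity>x. average_occupation F A Q' \<pi> x * ennreal (pmf \<nu> x))
          = (\<Sum>\<^sub>\<infinity>x. (\<Squnion>\<pi>\<in>markov_policies F. average_occupation F A Q' \<pi> x) * ennreal (pmf \<nu> x))"
    (is "?reach = ?avg \<and> ?avg = ?value")
proof -
  \<comment> \<open>The common value: the reach probability from any initial law and the average
    occupation from a point mass both equal \<open>R\<close>.\<close>
  define R where "R \<pi> \<mu> = (SUP t. occupation A Q' \<pi> \<mu> t)" for \<pi> :: "('x, 'u) policy" and \<mu>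
  define V where "V x = (SUP \<pi>\<in>markov_policies F. R \<pi> (return_pmf x))" for x
  have markov: "markov_policies F \<subseteq> policies F"
    by (auto simp: markov_policies_def)
  have mixture: "R \<pi> \<nu> = (\<integral>\<^sup>+x. R \<pi> (return_pmf x) \<partial>measure_pmf \<nu>)" if "\<pi> \<in> policies F" for \<pi>
    unfolding R_def by (rule SUP_occupation_mixture[OF that assms(2)])
  have reach: "?reach = (SUP \<pi>\<in>policies F. R \<pi> \<nu>)"
    unfolding R_def by (intro SUP_cong refl reach_probability_eq assms)
  have average: "average_occupation F A Q' \<pi> x = R \<pi> (return_pmf x)" if "\<pi> \<in> policies F" for \<pi> x
    unfolding R_def by (rule average_occupation_eq[OF that assms(2)])
  have avg: "?avg = (SUP \<pi>\<in>markov_policies F. R \<pi> \<nu>)"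
    using markov by (intro SUP_cong refl) (simp add: infsum_mult_pmf average mixture subset_eq)
  have "(SUP \<pi>\<in>markov_policies F. average_occupation F A Q' \<pi> x) = V x" for x
    unfolding V_def using markov by (intro SUP_cong refl) (simp add: average subset_eq)
  then have val: "?value = (\<integral>\<^sup>+x. V x \<partial>measure_pmf \<nu>)"
    by (simp add: infsum_mult_pmf)
  \<comment> \<open>First link of a cycle: general policies are bounded by Markov ones, these by the
    integral of \<open>V\<close>, and that again by general policies.\<close>
  have "(SUP \<pi>\<in>policies F. R \<pi> \<nu>) \<le> (SUP \<pi>\<in>markov_policies F. R \<pi> \<nu>)"
  proof (rule SUP_mono)
    fix \<pi> assume \<pi>: "\<pi> \<in> policies F"
    \<comment> \<open>\<open>([], x)\<close> is an admissible history for every \<open>x\<close>, so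
      the existence of a policy makes each \<open>F x\<close> nonempty, as the fallback action of
      \<open>markov_version\<close> requires.\<close>
    have "F x \<noteq> {}" for x
      using policies_set_pmf[OF \<pi>, of "([], x)" 0] set_pmf_not_empty[of "\<pi> 0 ([], x)"]
      by (auto simp: histories_def)
    then have "markov_version F Q' \<nu> \<pi> \<in> markov_policies F"
      by (rule markov_version_in_markov_policies[OF \<pi>])
    then show "\<exists>\<rho>\<in>markov_policies F. R \<pi> \<nu> \<le> R \<rho> \<nu>"
      by (intro bexI[of _ "markov_version F Q' \<nu> \<pi>"]) (simp_all add: R_def occupation_markov_version)
  qed
  moreover have "(SUP \<pi>\<in>markov_policies F. R \<pi> \<nu>) \<le> (\<integral>\<^sup>+x. V x \<partial>measure_pmf \<nu>)"
    using markov
    by (auto simp: mixture subset_eq V_def intro!: SUP_least nn_integral_mono SUP_upper)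
  moreover have "(\<integral>\<^sup>+x. V x \<partial>measure_pmf \<nu>) \<le> (SUP \<pi>\<in>policies F. R \<pi> \<nu>)"
  proof (cases "markov_policies F = {}")
    \<comment> \<open>\<open>V\<close> is then a supremum over the empty set, hence 0
      everywhere.\<close>
    case True
    then show ?thesis by (simp add: V_def bot_ennreal)
  next
    case False
    have V_fin: "V x < top" for x
    proof -
      have "V x \<le> 1"
        unfolding V_def R_def by (intro SUP_least occupation_le_1)
      then show ?thesis by (rule le_less_trans) simp
    qed
    show ?thesis
    proof (rule ennreal_le_epsilon)
      fix e :: real assume e: "0 < e"
      \<comment> \<open>A best policy for \<open>x\<close> need not exist, so an
        \<open>e\<close>-optimal one is chosen for each \<open>x\<close>. Their gluing need not be
        Markov, whence the comparison with the supremum over all policies.\<close>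
      have "\<exists>\<pi>\<in>markov_policies F. V x \<le> R \<pi> (return_pmf x) + ennreal e" for x
        using SUP_approx_ennreal[OF e False V_def, of x] V_fin[of x]
        by (auto simp: less_top intro: less_imp_le)
      then obtain \<pi> where \<pi>: "\<And>x. \<pi> x \<in> markov_policies F"
        and V_le: "\<And>x. V x \<le> R (\<pi> x) (return_pmf x) + ennreal e"
        by metis
      define \<rho> where "\<rho> = (\<lambda>t h. \<pi> (first_state h) t h)"
      have \<rho>: "\<rho> \<in> policies F"
        unfolding \<rho>_def using \<pi> markov by (intro glued_in_policies[of \<pi>]) blast
      have "R \<rho> (return_pmf x) = R (\<pi> x) (return_pmf x)" for x
        unfolding R_def occupation_def \<rho>_def history_pmf_glued[of _ \<pi>] ..
      then have "(\<integral>\<^sup>+x. V x \<partial>measure_pmf \<nu>) \<le> (\<integral>\<^sup>+x. R \<rho> (return_pmf x) + ennreal e \<partial>measure_pmf \<nu>)"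
        using V_le by (intro nn_integral_mono) simp
      also have "\<dots> = R \<rho> \<nu> + ennreal e"
        by (simp add: nn_integral_add mixture[OF \<rho>])
      also have "\<dots> \<le> (SUP \<pi>\<in>policies F. R \<pi> \<nu>) + ennreal e"
        using \<rho> by (intro add_right_mono SUP_upper)
      finally show "(\<integral>\<^sup>+x. V x \<partial>measure_pmf \<nu>) \<le> (SUP \<pi>\<in>policies F. R \<pi> \<nu>) + ennreal e" .
    qed
  qed
  moreover have "(SUP \<pi>\<in>markov_policies F. R \<pi> \<nu>) \<le> (SUP \<pi>\<in>policies F. R \<pi> \<nu>)"
    using markov by (rule SUP_subset_mono) simp
  ultimately show ?thesis
    unfolding reach avg val by (intro conjI antisym) (blast intro: order_trans)+
qed

end
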